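(* Let $\mathrm{Met}_n$ and $\mathrm{Cut}_n$ denote the metric cone and the cut cone in $\mathbb{R}^{\binom{n}{2}}$, and let $Is(\cdot)$ denote the symmetry group. For every integer $n\ge 5$, the groups $Is(\mathrm{Met}_n)$ and $Is(\mathrm{Cut}_n)$ are both isomorphic to $\mathrm{Sym}(n)$. For $n=4$, the groups $Is(\mathrm{Met}_4)$ and $Is(\mathrm{Cut}_4)$ are both isomorphic to $\mathrm{Sym}(3)\times \mathrm{Sym}(4)$.
   Context: Let $V_n=\{1,\dots,n\}$. Points of $\mathbb{R}^{\binom{n}{2}}$ are written $x=(x_{ij})_{1\le i<j\le n}$, with the convention $x_{ji}=x_{ij}$, and $\mathbb{R}^{\binom{n}{2}}$ carries its standard Euclidean structure. For $S\subseteq V_n$, the cut (vector) $\delta(S)\in\mathbb{R}^{\binom{n}{2}}$ is defined by $\delta(S)_{ij}=1$ if exactly one of $i,j$ lies in $S$, and $\delta(S)_{ij}=0$ otherwise. The cut cone $\mathrm{Cut}_n$ is the conic hull (set of all nonnegative linear combinations) of the $2^{n-1}-1$ nonzero cuts. The metric cone $\mathrm{Met}_n$ is the set of all $x\in\mathbb{R}^{\binom{n}{2}}$ satisfying the triangle inequalities $x_{ij}-x_{ik}-x_{jk}\le 0$ for all triples of distinct $i,j,k\in V_n$. For a polyhedron $P\subseteq\mathbb{R}^{N}$, an isometry of $P$ is a linear transformation $g$ of $\mathbb{R}^{N}$ preserving the Euclidean distance and such that $g(P)=P$; the symmetry group $Is(P)$ is the group of all isometries of $P$ under composition. $\mathrm{Sym}(m)$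 denotes the symmetric group on $m$ letters. *)

theory Defs
  imports "HOL-Analysis.Analysis" "HOL-Algebra.Sym_Groups"
begin

text \<open>
  The vertex set is the universe of a type \<open>'n\<close> with at least two elements, so that
  the integer parameter is \<open>CARD('n)\<close>. The coordinates are indexed by the two-element
  sets of vertices; this builds in the convention \<open>x\<^sub>i\<^sub>j = x\<^sub>j\<^sub>i\<close>, and gives the
  Euclidean space of dimension \<open>CARD('n) choose 2\<close>, each pair being counted once.
\<close>

typedef ('n::card2) edge = "{e :: 'n set. card e = 2}"
proof -
  have "2 \<le> card (UNIV :: 'n set)" by (rule two_le_card)
  then obtain e :: "'n set" where "card e = 2"
    by (metis obtain_subset_with_card_n)
  then show ?thesis by blast
qed

instance edge :: (card2) finite
proof
  have "finite (range (Rep_edge :: 'a edge \<Rightarrow> 'a set))" by simp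
  then show "finite (UNIV :: 'a edge set)"
    by (rule finite_imageD) (simp add: inj_on_def Rep_edge_inject)
qed

lemma card_edge: "CARD(('n::card2) edge) = CARD('n) choose 2"
proof -
  have "range (Rep_edge :: 'n edge \<Rightarrow> 'n set) = {e. card e = 2}"
    using type_definition.Rep_range[OF type_definition_edge] .
  moreover have "card (range (Rep_edge :: 'n edge \<Rightarrow> 'n set)) = CARD('n edge)"
    by (rule card_image) (simp add: inj_on_def Rep_edge_inject)
  ultimately show ?thesis
    using n_subsets[of "UNIV :: 'n set" 2] by simp
qed

text \<open>Meaningful only for \<open>i \<noteq> j\<close>.\<close>
definition coord :: "real ^ ('n::card2) edge \<Rightarrow> 'n \<Rightarrow> 'n \<Rightarrow> real"
  where "coord x i j = x $ Abs_edge {i, j}"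

definition cut :: "('n::card2) set \<Rightarrow> real ^ 'n edge"
  where "cut S = (\<chi> e. if card (Rep_edge e \<inter> S) = 1 then 1 else 0)"

lemma coord_cut:
  assumes "i \<noteq> j"
  shows "coord (cut S) i j = (if (i \<in> S) \<noteq> (j \<in> S) then 1 else 0)"
proof -
  have "Rep_edge (Abs_edge {i, j}) = {i, j}"
    using assms by (simp add: Abs_edge_inverse)
  then show ?thesis
    using assms by (auto simp: coord_def cut_def Int_insert_left)
qed

definition cut_cone :: "(real ^ ('n::card2) edge) set"
  where "cut_cone = convex_cone hull {cut S | S. cut S \<noteq> 0}"

definition met_cone :: "(real ^ ('n::card2) edge) set"
  where "met_cone = {x. \<forall>i j k. i \<noteq> j \<and> i \<noteq> k \<and> j \<noteq> k \<longrightarrow>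
                          coord x i j - coord x i k - coord x j k \<le> 0}"

definition symmetry_group :: "'a::euclidean_space set \<Rightarrow> ('a \<Rightarrow> 'a) monoid"
  where "symmetry_group P =
    \<lparr>carrier = {g. linear g \<and> (\<forall>x y. dist (g x) (g y) = dist x y) \<and> g ` P = P},
     mult = (\<circ>), one = id\<rparr>"

lemma group_symmetry_group: "group (symmetry_group P)"
proof (rule groupI)
  fix g assume "g \<in> carrier (symmetry_group P)"
  then have g: "linear g" "\<And>x y. dist (g x) (g y) = dist x y" "g ` P = P"
    by (auto simp: symmetry_group_def)
  have ot: "orthogonal_transformation g"
    using g by (simp add: orthogonal_transformation_isometry linear_0)
  then have bij: "bij g" by (rule orthogonal_transformation_bij)
  have "orthogonal_transformation (inv_into UNIV g)"
    using ot by (rule orthogonal_transformation_inv)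
  moreover have "inv_into UNIV g ` P = P"
    using g(3) bij by (metis bij_is_inj image_inv_f_f)
  ultimately have "inv_into UNIV g \<in> carrier (symmetry_group P)"
    by (auto simp: symmetry_group_def orthogonal_transformation_isometry
        orthogonal_transformation_linear)
  moreover have "inv_into UNIV g \<otimes>\<^bsub>symmetry_group P\<^esub> g = \<one>\<^bsub>symmetry_group P\<^esub>"
    using bij by (simp add: symmetry_group_def bij_is_inj)
  ultimately show "\<exists>h\<in>carrier (symmetry_group P).
      h \<otimes>\<^bsub>symmetry_group P\<^esub> g = \<one>\<^bsub>symmetry_group P\<^esub>" by blast
next
  fix g h assume "g \<in> carrier (symmetry_group P)" "h \<in> carrier (symmetry_group P)"
  then show "g \<otimes>\<^bsub>symmetry_group P\<^esub> h \<in> carrier (symmetry_group P)"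
    by (simp add: symmetry_group_def linear_compose) (metis image_image)
qed (auto simp: symmetry_group_def o_assoc linear_id)

end

theory Submission
  imports Defs
begin

text \<open>
  An isometry of the cut cone permutes its extreme rays, which are spanned by the cuts. Two distinct
  cuts have cosine at least \<open>1 / (n - 1)\<close>, with equality only when both are cuts of single vertices,
  so these are permuted and yield a vertex permutation. The inner products with the cuts of single
  vertices determine the image of \<open>\<delta>({i, j})\<close> as soon as \<open>n \<noteq> 4\<close>, and
  \<open>2 e\<^sub>i\<^sub>j = \<delta>({i}) + \<delta>({j}) - \<delta>({i, j})\<close>.

  An isometry of the metric cone permutes the facet normals \<open>e\<^sub>i\<^sub>j - e\<^sub>i\<^sub>k - e\<^sub>j\<^sub>k\<close>. For \<open>n \<ge> 5\<close>
  the vectors \<open>- 2 e\<^sub>j\<^sub>k\<close> are characterised among sums of two normals by inner products with the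
  normals; so the isometry permutes the coordinates, maps triangles to triangles, and comes from a
  vertex permutation.

  For \<open>n = 4\<close> the two cones agree, and any permutation of the four cuts of single vertices can be
  combined with any permutation of the three cuts of pairs, since this preserves all inner products.
\<close>

subsection \<open>Coordinates and vertex permutations\<close>

lemma Rep_Abs_edge [simp]: "i \<noteq> j \<Longrightarrow> Rep_edge (Abs_edge {i, j}) = {i, j}"
  by (simp add: Abs_edge_inverse)

lemma Abs_edge_eq_iff:
  assumes "i \<noteq> j" "k \<noteq> l"
  shows "Abs_edge {i, j} = Abs_edge {k, l} \<longleftrightarrow> {i, j} = {k, l}"
  using assms by (metis Rep_Abs_edge)

lemma edge_cases:
  obtains i j where "i \<noteq> j" "e = Abs_edge {i, j}"
proof -
  have "card (Rep_edge e) = 2" using Rep_edge[of e] by simp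
  then obtain i j where "Rep_edge e = {i, j}" "i \<noteq> j" by (auto simp: card_2_iff)
  then show ?thesis using that by (metis Rep_edge_inverse)
qed

lemma card_Compl: "card (- S) = CARD('a) - card (S :: 'a::finite set)"
  by (simp add: Compl_eq_Diff_UNIV card_Diff_subset)

lemma coord_ext:
  assumes "\<And>i j. i \<noteq> j \<Longrightarrow> coord x i j = coord y i j"
  shows "x = y"
  using assms unfolding vec_eq_iff coord_def by (metis edge_cases)

lemma coord_sym: "coord x i j = coord x j i"
  by (simp add: coord_def insert_commute)

lemma coord_add [simp]: "coord (x + y) i j = coord x i j + coord y i j"
  and coord_diff [simp]: "coord (x - y) i j = coord x i j - coord y i j"
  and coord_scaleR [simp]: "coord (c *\<^sub>R x) i j = c * coord x i j"
  and coord_zero [simp]: "coord 0 i j = 0"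
  by (simp_all add: coord_def)

section \<open>Coordinate vectors of edges\<close>

definition edge_vec :: "'n::card2 \<Rightarrow> 'n \<Rightarrow> real ^ 'n edge"
  where "edge_vec i j = axis (Abs_edge {i, j}) 1"

lemma edge_vec_sym: "edge_vec i j = edge_vec j i"
  by (simp add: edge_vec_def insert_commute)

lemma inner_edge_vec [simp]: "edge_vec i j \<bullet> x = coord x i j" "x \<bullet> edge_vec i j = coord x i j"
  by (simp_all add: edge_vec_def coord_def inner_axis inner_axis')

lemma coord_edge_vec:
  assumes "i \<noteq> j" "k \<noteq> l"
  shows "coord (edge_vec i j) k l = (if {i, j} = {k, l} then 1 else 0)"
  using Abs_edge_eq_iff[OF assms] by (auto simp: edge_vec_def coord_def axis_def)

lemma edge_vec_eq_iff:
  assumes "i \<noteq> j" "k \<noteq> l"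
  shows "edge_vec i j = edge_vec k l \<longleftrightarrow> {i, j} = {k, l}"
  using Abs_edge_eq_iff[OF assms] by (simp add: edge_vec_def axis_eq_axis)

lemma linear_eq_edge_vec:
  fixes f g :: "real ^ ('n::card2) edge \<Rightarrow> 'b::real_vector"
  assumes "linear f" "linear g" "\<And>i j. i \<noteq> j \<Longrightarrow> f (edge_vec i j) = g (edge_vec i j)"
  shows "f = g"
proof
  fix x
  have "x \<in> span (Basis :: (real ^ 'n edge) set)" by simp
  moreover have "f b = g b" if "b \<in> Basis" for b
  proof -
    from that obtain e where "b = axis e 1" by (auto simp: Basis_vec_def)
    then show ?thesis using assms(3) by (metis edge_cases edge_vec_def)
  qed
  ultimately show "f x = g x" using linear_eq_on[OF assms(1,2)] by blast
qed

text \<open>The preimage moves the coordinate at \<open>{i, j}\<close> to \<open>{s i, s j}\<close>,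
  so that composition keeps its order. For other than bijective \<open>s\<close> the preimage of an
  edge need not be an edge, hence the bijectivity assumptions in the lemmas on coordinates.\<close>

definition vperm :: "('n::card2 \<Rightarrow> 'n) \<Rightarrow> real ^ 'n edge \<Rightarrow> real ^ 'n edge"
  where "vperm s x = (\<chi> e. x $ Abs_edge (s -` Rep_edge e))"

lemma linear_vperm: "linear (vperm s)"
  by (rule linearI) (simp_all add: vperm_def vec_eq_iff)

lemma coord_vperm:
  assumes "bij s" "i \<noteq> j"
  shows "coord (vperm s x) (s i) (s j) = coord x i j"
proof -
  have "s i \<noteq> s j" using assms by (metis bij_pointE)
  moreover have "s -` {s i, s j} = {i, j}" using assms by (auto simp: bij_def inj_eq)
  ultimately show ?thesis by (simp add: vperm_def coord_def)
qed

text \<open>This is extensionality in the shape in which \<open>coord_vperm\<close> evaluates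
  coordinates.\<close>

lemma coord_ext_bij:
  fixes s :: "'a \<Rightarrow> 'b::card2"
  assumes "bij s" "\<And>i j. i \<noteq> j \<Longrightarrow> coord x (s i) (s j) = coord y (s i) (s j)"
  shows "x = y"
proof (rule coord_ext)
  fix i j :: 'b assume "i \<noteq> j"
  moreover obtain i' where "i = s i'" using bij_is_surj[OF assms(1)] by (rule surjE)
  moreover obtain j' where "j = s j'" using bij_is_surj[OF assms(1)] by (rule surjE)
  ultimately show "coord x i j = coord y i j" using assms(2)[of i' j'] by auto
qed

lemma vperm_comp:
  assumes "bij s" "bij t"
  shows "vperm (s \<circ> t) = vperm s \<circ> vperm t"
proof
  fix x
  have *: "bij (s \<circ> t)" using assms by (rule bij_comp[rotated])
  show "vperm (s \<circ> t) x = (vperm s \<circ> vperm t) x"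
  proof (rule coord_ext_bij[OF *])
    fix i j :: 'a assume ij: "i \<noteq> j"
    then have "t i \<noteq> t j" using assms(2) by (metis bij_pointE)
    then show "coord (vperm (s \<circ> t) x) ((s \<circ> t) i) ((s \<circ> t) j)
        = coord ((vperm s \<circ> vperm t) x) ((s \<circ> t) i) ((s \<circ> t) j)"
      using coord_vperm[OF * ij, of x] coord_vperm[OF assms(2) ij, of x]
        coord_vperm[OF assms(1), of "t i" "t j" "vperm t x"] by simp
  qed
qed

lemma vperm_cut:
  assumes "bij s"
  shows "vperm s (cut S) = cut (s ` S)"
proof (rule coord_ext_bij[OF assms])
  fix i j :: 'a assume ij: "i \<noteq> j"
  then have "s i \<noteq> s j" using assms by (metis bij_pointE)
  then show "coord (vperm s (cut S)) (s i) (s j) = coord (cut (s ` S)) (s i) (s j)"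
    using assms by (simp add: coord_vperm ij coord_cut bij_def inj_image_mem_iff)
qed

lemma vperm_edge_vec:
  assumes "bij s" "i \<noteq> j"
  shows "vperm s (edge_vec i j) = edge_vec (s i) (s j)"
proof (rule coord_ext_bij[OF assms(1)])
  fix k l :: 'a assume kl: "k \<noteq> l"
  have inj: "\<And>i j. s i = s j \<longleftrightarrow> i = j" using assms by (simp add: bij_def inj_eq)
  show "coord (vperm s (edge_vec i j)) (s k) (s l) = coord (edge_vec (s i) (s j)) (s k) (s l)"
    using assms kl by (simp add: coord_vperm coord_edge_vec inj doubleton_eq_iff)
qed

lemma orthogonal_vperm:
  fixes s :: "'n::card2 \<Rightarrow> 'n"
  assumes "bij s"
  shows "orthogonal_transformation (vperm s)"
  unfolding orthogonal_transformation_def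
proof (intro conjI allI linear_vperm)
  fix x y :: "real ^ 'n edge"
  \<comment> \<open>\<open>f\<close> is the permutation of the edges induced by the inverse of
    \<open>s\<close>; \<open>vperm s\<close> merely reindexes coordinates along it.\<close>
  define f where "f e = Abs_edge (s -` Rep_edge e)" for e
  have f: "f (Abs_edge {s i, s j}) = Abs_edge {i, j}" if "i \<noteq> j" for i j
  proof -
    have "s i \<noteq> s j" using assms that by (metis bij_pointE)
    moreover have "s -` {s i, s j} = {i, j}" using assms by (auto simp: bij_def inj_eq)
    ultimately show ?thesis by (simp add: f_def)
  qed
  have "surj f" unfolding surj_def by (metis edge_cases f)
  then have "bij f" by (simp add: bij_def finite_UNIV_surj_inj)
  have "vperm s x \<bullet> vperm s y = (\<Sum>e\<in>UNIV. x $ f e * y $ f e)"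
    by (simp add: inner_vec_def vperm_def f_def)
  also have "\<dots> = (\<Sum>e\<in>UNIV. x $ e * y $ e)"
    by (rule sum.reindex_bij_betw[OF \<open>bij f\<close>])
  finally show "vperm s x \<bullet> vperm s y = x \<bullet> y" by (simp add: inner_vec_def)
qed

subsection \<open>Symmetry groups\<close>

lemma symmetry_group_carrier:
  "g \<in> carrier (symmetry_group P) \<longleftrightarrow> orthogonal_transformation g \<and> g ` P = P"
  unfolding symmetry_group_def
  by (auto simp: orthogonal_transformation_isometry orthogonal_transformation_linear linear_0)

lemma symmetry_group_mult [simp]: "g \<otimes>\<^bsub>symmetry_group P\<^esub> h = g \<circ> h"
  by (simp add: symmetry_group_def)

text \<open>Preimages and images of convex cones under a linear map are convex cones, so minimality
  of the hull gives each inclusion.\<close>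

lemma convex_cone_hull_linear_image:
  assumes "linear f"
  shows "f ` (convex_cone hull S) = convex_cone hull (f ` S)"
proof
  have "convex_cone (f -` (convex_cone hull (f ` S)))"
    by (rule convex_cone_iff[THEN iffD2])
      (simp add: assms linear_0 linear_add linear_cmul convex_cone_hull_add convex_cone_hull_mul
        convex_cone_hull_contains_0)
  then have "convex_cone hull S \<subseteq> f -` (convex_cone hull (f ` S))"
    by (intro hull_minimal) (auto intro: hull_inc)
  then show "f ` (convex_cone hull S) \<subseteq> convex_cone hull (f ` S)" by blast
  show "convex_cone hull (f ` S) \<subseteq> f ` (convex_cone hull S)"
    by (intro hull_minimal image_mono hull_subset)
      (simp add: assms convex_cone_linear_image convex_cone_convex_cone_hull)
qed

section \<open>Cuts as bipartitions of the vertices\<close>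

lemma cut_eq_0_iff: "cut S = 0 \<longleftrightarrow> S = {} \<or> S = UNIV"
proof
  assume "cut S = 0"
  then have "i \<in> S \<longleftrightarrow> j \<in> S" if "i \<noteq> j" for i j
    using coord_cut[OF that, of S] by (auto split: if_splits)
  then have "i \<in> S \<longleftrightarrow> j \<in> S" for i j by metis
  then show "S = {} \<or> S = UNIV" by auto
next
  assume "S = {} \<or> S = UNIV"
  then show "cut S = 0" by (intro coord_ext) (auto simp: coord_cut)
qed

text \<open>A cut records only which pairs are separated. If two cuts agree, then whether
  \<open>S\<close> and \<open>T\<close> agree at a vertex is the same for all vertices.\<close>

lemma cut_eq_iff: "cut S = cut T \<longleftrightarrow> S = T \<or> S = - T"
proof
  assume *: "cut S = cut T"
  then have "(i \<in> S \<longleftrightarrow> j \<in> S) \<longleftrightarrow> (i \<in> T \<longleftrightarrow> j \<in> T)" if "i \<noteq> j" for i j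
    using coord_cut[OF that, of S] coord_cut[OF that, of T] by (auto split: if_splits)
  then have "(i \<in> S \<longleftrightarrow> i \<in> T) \<longleftrightarrow> (j \<in> S \<longleftrightarrow> j \<in> T)" for i j by metis
  then have "(\<forall>i. i \<in> S \<longleftrightarrow> i \<in> T) \<or> (\<forall>i. i \<in> S \<longleftrightarrow> i \<notin> T)" by metis
  then show "S = T \<or> S = - T" by auto
next
  assume "S = T \<or> S = - T"
  then show "cut S = cut T" by (intro coord_ext) (auto simp: coord_cut)
qed

text \<open>With two vertices, \<open>{i}\<close> would be the complement of \<open>{j}\<close>;
  from three vertices on, counting excludes this.\<close>

lemma cut_singleton_eq_iff:
  assumes "3 \<le> CARD('n::card2)"
  shows "cut {i :: 'n} = cut {j} \<longleftrightarrow> i = j"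
proof -
  have "{i} \<noteq> - {j}"
  proof
    assume "{i} = - {j}"
    then have "card {i} = CARD('n) - card {j}" by (simp add: card_Compl)
    then show False using assms by simp
  qed
  then show ?thesis by (auto simp: cut_eq_iff)
qed

lemma vperm_symmetry_cut:
  fixes s :: "'n::card2 \<Rightarrow> 'n"
  assumes "bij s"
  shows "vperm s \<in> carrier (symmetry_group cut_cone)"
proof -
  have s: "s ` S = {} \<longleftrightarrow> S = {}" "s ` S = UNIV \<longleftrightarrow> S = UNIV" for S
    using assms by (simp, metis bij_is_inj bij_is_surj inj_image_eq_iff)
  have "cut T \<in> vperm s ` {cut S | S. cut S \<noteq> 0}" if "cut T \<noteq> 0" for T :: "'n set"
  proof -
    have "T = s ` (s -` T)" using assms by (simp add: bij_is_surj)
    then have "cut T = vperm s (cut (s -` T))" "cut (s -` T) \<noteq> 0"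
      using that s[of "s -` T"] by (auto simp: vperm_cut assms cut_eq_0_iff)
    then show ?thesis by blast
  qed
  then have "vperm s ` {cut S | S. cut S \<noteq> 0} = {cut S | S. cut S \<noteq> 0}"
    using s by (auto simp: vperm_cut[OF assms] cut_eq_0_iff)
  then show ?thesis
    by (simp add: symmetry_group_carrier orthogonal_vperm assms cut_cone_def
        convex_cone_hull_linear_image linear_vperm)
qed

lemma vperm_met:
  assumes "bij s"
  shows "vperm s x \<in> met_cone \<longleftrightarrow> x \<in> met_cone"
proof -
  have inj: "s i = s j \<longleftrightarrow> i = j" for i j using assms by (simp add: bij_def inj_eq)
  \<comment> \<open>Each quantifier is pulled back along the surjection \<open>s\<close>, so that
    \<open>coord_vperm\<close> applies to every coordinate.\<close>
  have all: "(\<forall>i. Q i) \<longleftrightarrow> (\<forall>i. Q (s i))" for Q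
    using bij_is_surj[OF assms] by (metis surjD)
  have "vperm s x \<in> met_cone \<longleftrightarrow> (\<forall>i j k. s i \<noteq> s j \<and> s i \<noteq> s k \<and> s j \<noteq> s k \<longrightarrow>
      coord (vperm s x) (s i) (s j) - coord (vperm s x) (s i) (s k)
        - coord (vperm s x) (s j) (s k) \<le> 0)"
    unfolding met_cone_def mem_Collect_eq by (subst (1 2 3) all) (rule refl)
  also have "\<dots> \<longleftrightarrow> x \<in> met_cone"
    by (auto simp: met_cone_def inj coord_vperm[OF assms])
  finally show ?thesis .
qed

lemma vperm_symmetry_met:
  assumes "bij s"
  shows "vperm s \<in> carrier (symmetry_group met_cone)"
proof -
  have "surj (vperm s)" using orthogonal_vperm[OF assms] by (rule orthogonal_transformation_surj)
  then have "vperm s ` met_cone = met_cone" using vperm_met[OF assms]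
    by (auto simp: image_iff) (metis surjD)
  then show ?thesis by (simp add: symmetry_group_carrier orthogonal_vperm assms)
qed

subsection \<open>Isomorphisms with symmetric groups\<close>

text \<open>This is the conjugate of \<open>g\<close> by the enumeration \<open>e\<close>. It is the
  identity outside \<open>{1..n}\<close> because \<open>permutes\<close> demands this of the
  elements of \<open>sym_group n\<close>.\<close>

definition index_perm :: "nat \<Rightarrow> (nat \<Rightarrow> 'a) \<Rightarrow> ('a \<Rightarrow> 'a) \<Rightarrow> nat \<Rightarrow> nat"
  where "index_perm n e g k = (if k \<in> {1..n} then inv_into {1..n} e (g (e k)) else k)"

context
  fixes n :: nat and e :: "nat \<Rightarrow> 'a" and A :: "'a set"
  assumes e: "bij_betw e {1..n} A"
begin

lemma index_perm_apply:
  assumes "g ` A = A" "k \<in> {1..n}"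
  shows "e (index_perm n e g k) = g (e k)"
proof -
  have "g (e k) \<in> e ` {1..n}" using assms e by (auto simp: bij_betw_def)
  then show ?thesis by (simp only: index_perm_def assms(2) if_True f_inv_into_f)
qed

lemma index_perm_permutes:
  assumes "g ` A = A" "inj g"
  shows "index_perm n e g permutes {1..n}"
proof (rule bij_imp_permutes)
  have "bij_betw g A A" using assms by (auto simp: bij_betw_def inj_on_def)
  then have "bij_betw (inv_into {1..n} e \<circ> (g \<circ> e)) {1..n} {1..n}"
    using e by (blast intro: bij_betw_trans bij_betw_inv_into)
  then show "bij_betw (index_perm n e g) {1..n} {1..n}"
    by (rule bij_betw_cong[THEN iffD1, rotated]) (simp add: index_perm_def)
qed (auto simp: index_perm_def)

lemma index_perm_comp:
  assumes "g ` A = A" "h ` A = A"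
  shows "index_perm n e (g \<circ> h) = index_perm n e g \<circ> index_perm n e h"
proof
  fix k
  show "index_perm n e (g \<circ> h) k = (index_perm n e g \<circ> index_perm n e h) k"
  proof (cases "k \<in> {1..n}")
    case True
    then have "e k \<in> A" using e by (auto simp: bij_betw_def)
    then have "h (e k) \<in> e ` {1..n}" using assms e by (auto simp: bij_betw_def)
    then have *: "e (inv_into {1..n} e (h (e k))) = h (e k)" "inv_into {1..n} e (h (e k)) \<in> {1..n}"
      by (simp_all only: f_inv_into_f inv_into_into)
    then show ?thesis by (simp add: index_perm_def True del: atLeastAtMost_iff)
  qed (auto simp: index_perm_def)
qed

lemma index_perm_inj:
  assumes "g ` A = A" "h ` A = A" "index_perm n e g = index_perm n e h" "x \<in> A"
  shows "g x = h x"
proof -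
  obtain k where "k \<in> {1..n}" "x = e k" using assms e by (auto simp: bij_betw_def)
  then show ?thesis using assms(3) index_perm_apply[OF assms(1)] index_perm_apply[OF assms(2)] by metis
qed

text \<open>Only the values of \<open>g\<close> on \<open>A\<close> are prescribed, so this also
  covers linear maps that extend a permutation of finitely many vectors.\<close>

lemma index_perm_surj:
  assumes "p permutes {1..n}" "\<And>x. x \<in> A \<Longrightarrow> g x = e (p (inv_into {1..n} e x))"
  shows "index_perm n e g = p"
proof
  fix k
  show "index_perm n e g k = p k"
  proof (cases "k \<in> {1..n}")
    case True
    then have "e k \<in> A" "p k \<in> {1..n}" using e permutes_in_image[OF assms(1)]
      by (auto simp: bij_betw_def simp del: atLeastAtMost_iff)
    then show ?thesis using True e assms(2)
      by (simp add: index_perm_def bij_betw_def inv_into_f_f del: atLeastAtMost_iff)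
  next
    case False
    then show ?thesis using assms(1) by (simp add: index_perm_def permutes_not_in del: atLeastAtMost_iff)
  qed
qed

lemma transported_permutes:
  assumes "p permutes {1..n}"
  shows "bij_betw (\<lambda>x. e (p (inv_into {1..n} e x))) A A"
proof -
  have "bij_betw (e \<circ> (p \<circ> inv_into {1..n} e)) A A"
    using e assms by (blast intro: bij_betw_trans bij_betw_inv_into permutes_imp_bij)
  then show ?thesis by (simp add: o_def)
qed

end

text \<open>The group \<open>G\<close> of bijections of the vertices mediates: \<open>vperm\<close>
  maps it isomorphically to the symmetry group, and \<open>index_perm\<close> to the symmetric
  group.\<close>

lemma symmetry_group_iso_sym:
  fixes P :: "(real ^ ('n::card2) edge) set"
  assumes n: "3 \<le> CARD('n)"
    and carr: "carrier (symmetry_group P) = vperm ` {s. bij s}"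
  shows "symmetry_group P \<cong> sym_group CARD('n)"
proof -
  obtain e :: "nat \<Rightarrow> 'n" where e: "bij_betw e {1..CARD('n)} UNIV"
    using ex_bij_betw_nat_finite_1[of "UNIV :: 'n set"] by auto
  define G where "G = \<lparr>carrier = {s :: 'n \<Rightarrow> 'n. bij s}, mult = (\<lambda>s t. s \<circ> t), one = id :: 'n \<Rightarrow> 'n\<rparr>"
  \<comment> \<open>A vertex bijection can be read off from its action on the cuts of single
    vertices.\<close>
  have inj: "inj_on (vperm :: ('n \<Rightarrow> 'n) \<Rightarrow> _) {s. bij s}"
  proof (rule inj_onI)
    fix s t :: "'n \<Rightarrow> 'n" assume st: "s \<in> {s. bij s}" "t \<in> {s. bij s}" "vperm s = vperm t"
    show "s = t"
    proof
      fix i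
      have "cut {s i} = cut {t i}" using st vperm_cut[of s "{i}"] vperm_cut[of t "{i}"] by simp
      then show "s i = t i" by (simp add: cut_singleton_eq_iff n)
    qed
  qed
  have 1: "vperm \<in> iso G (symmetry_group P)"
    using inj by (auto simp: iso_def hom_def G_def carr bij_betw_def vperm_comp)
  have 2: "index_perm CARD('n) e \<in> iso G (sym_group CARD('n))"
    unfolding iso_def hom_def
  proof (intro CollectI conjI ballI bij_betwI')
    show "index_perm CARD('n) e \<in> carrier G \<rightarrow> carrier (sym_group CARD('n))"
      using index_perm_permutes[OF e] by (auto simp: G_def sym_group_def bij_def)
    fix g h assume gh: "g \<in> carrier G" "h \<in> carrier G"
    then have "range g = UNIV" "range h = UNIV" by (auto simp: G_def bij_def)
    note * = index_perm_comp[OF e this] index_perm_inj[OF e this]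
    show "index_perm CARD('n) e (g \<otimes>\<^bsub>G\<^esub> h) = 
      index_perm CARD('n) e g \<otimes>\<^bsub>sym_group CARD('n)\<^esub> index_perm CARD('n) e h"
      using *(1) by (simp add: G_def sym_group_def)
    show "(index_perm CARD('n) e g = index_perm CARD('n) e h) = (g = h)"
      using *(2) by auto
  next
    fix g assume "g \<in> carrier G"
    then show "index_perm CARD('n) e g \<in> carrier (sym_group CARD('n))"
      using index_perm_permutes[OF e] by (auto simp: G_def sym_group_def bij_def)
  next
    fix p assume "p \<in> carrier (sym_group CARD('n))"
    then have p: "p permutes {1..CARD('n)}" by (simp add: sym_group_def)
    show "\<exists>g\<in>carrier G. p = index_perm CARD('n) e g"
      using index_perm_surj[OF e p refl] transported_permutes[OF e p]
      by (intro bexI[of _ "\<lambda>x. e (p (inv_into {1..CARD('n)} e x))"]) (auto simp: G_def)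
  qed
  have "group G" unfolding G_def
  proof (rule groupI, simp_all add: bij_comp o_assoc)
    fix s :: "'n \<Rightarrow> 'n" assume "bij s"
    then show "\<exists>t. bij t \<and> t \<circ> s = id" by (metis bij_imp_bij_inv bij_is_inj inv_o_cancel)
  qed
  then interpret group G .
  show ?thesis
    using iso_set_trans[OF iso_set_sym[OF 1] 2] by (rule is_isoI)
qed

subsection \<open>The cut cone\<close>

text \<open>The inner product counts the edges separated by both \<open>S\<close> and
  \<open>T\<close>. Orient each such edge from its endpoint in \<open>S\<close>: this endpoint lies
  in \<open>T\<close> or not, and the other one is then outside both sets or in
  \<open>T - S\<close>.\<close>

lemma cut_inner:
  fixes S T :: "('n::card2) set"
  shows "cut S \<bullet> cut T
    = real (card (S \<inter> T) * card (- S \<inter> - T) + card (S - T) * card (T - S))"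
proof -
  let ?D = "(S \<inter> T) \<times> (- S \<inter> - T) \<union> (S - T) \<times> (T - S)"
  let ?f = "\<lambda>(i, j). Abs_edge {i, j}"
  have D: "i \<noteq> j" if "(i, j) \<in> ?D" for i j using that by auto
  have one: "card (Rep_edge (Abs_edge {i, j}) \<inter> S) = 1 \<longleftrightarrow> (i \<in> S) \<noteq> (j \<in> S)"
    if "i \<noteq> j" for i j and S :: "'n set"
    using that by (auto simp: Int_insert_left)
  have "cut S \<bullet> cut T
      = (\<Sum>e\<in>UNIV. if card (Rep_edge e \<inter> S) = 1 \<and> card (Rep_edge e \<inter> T) = 1 then 1 else 0)"
    by (auto simp: inner_vec_def cut_def intro!: sum.cong)
  also have "\<dots> = card {e. card (Rep_edge e \<inter> S) = 1 \<and> card (Rep_edge e \<inter> T) = 1}"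
    by (simp add: sum.If_cases)
  also have "{e. card (Rep_edge e \<inter> S) = 1 \<and> card (Rep_edge e \<inter> T) = 1} = ?f ` ?D"
  proof (intro equalityI subsetI)
    fix e assume e: "e \<in> {e. card (Rep_edge e \<inter> S) = 1 \<and> card (Rep_edge e \<inter> T) = 1}"
    obtain i j where ij: "i \<noteq> j" "e = Abs_edge {i, j}" by (rule edge_cases)
    with e have "(i, j) \<in> ?D \<or> (j, i) \<in> ?D" by (auto simp only: mem_Collect_eq one) auto
    moreover have "e = ?f (i, j)" "e = ?f (j, i)" using ij by (auto simp: insert_commute)
    ultimately show "e \<in> ?f ` ?D" by blast
  next
    fix e assume "e \<in> ?f ` ?D"
    then obtain i j where ij: "(i, j) \<in> ?D" "e = Abs_edge {i, j}" by auto
    with D[OF ij(1)] show "e \<in> {e. card (Rep_edge e \<inter> S) = 1 \<and> card (Rep_edge e \<inter> T) = 1}"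
      using one by auto
  qed
  also have "card (?f ` ?D) = card ?D"
  \<comment> \<open>Both products have their first component in \<open>S\<close> and their second
    outside \<open>S\<close>, so no edge is counted in both orientations.\<close>
  proof (rule card_image, rule inj_onI, clarify)
    fix i j k l
    assume "(i, j) \<in> ?D" "(k, l) \<in> ?D" "Abs_edge {i, j} = Abs_edge {k, l}"
    moreover from this have "{i, j} = {k, l}" using Abs_edge_eq_iff D by metis
    ultimately show "i = k \<and> j = l" by (auto simp: doubleton_eq_iff)
  qed
  also have "card ?D = card ((S \<inter> T) \<times> (- S \<inter> - T)) + card ((S - T) \<times> (T - S))"
    by (rule card_Un_disjoint) auto
  finally show ?thesis by (simp add: card_cartesian_product)
qed

lemma norm_cut: "(norm (cut S))\<^sup>2 = real (card S * card (- S))"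
  by (simp add: power2_norm_eq_inner cut_inner)

section \<open>Extreme rays and their images\<close>

lemma convex_cone_hull_finite_sum:
  assumes "finite R" "x \<in> convex_cone hull R"
  obtains u where "\<And>s. s \<in> R \<Longrightarrow> 0 \<le> u s" "x = (\<Sum>s\<in>R. u s *\<^sub>R s)"
proof -
  let ?C = "{x. \<exists>u. (\<forall>s\<in>R. 0 \<le> u s) \<and> x = (\<Sum>s\<in>R. u s *\<^sub>R s)}"
  have "convex_cone ?C"
  proof (rule convex_cone_iff[THEN iffD2], intro conjI ballI allI impI)
    show "0 \<in> ?C" by (auto intro!: exI[of _ "\<lambda>_. 0"])
  next
    fix x y assume "x \<in> ?C" "y \<in> ?C"
    then obtain u v where "\<forall>s\<in>R. 0 \<le> u s" "x = (\<Sum>s\<in>R. u s *\<^sub>R s)"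
      "\<forall>s\<in>R. 0 \<le> v s" "y = (\<Sum>s\<in>R. v s *\<^sub>R s)" by auto
    then show "x + y \<in> ?C"
      by (auto intro!: exI[of _ "\<lambda>s. u s + v s"] simp: scaleR_add_left sum.distrib)
  next
    fix x and c :: real assume "x \<in> ?C" "0 \<le> c"
    then obtain u where "\<forall>s\<in>R. 0 \<le> u s" "x = (\<Sum>s\<in>R. u s *\<^sub>R s)" by auto
    then show "c *\<^sub>R x \<in> ?C"
      using \<open>0 \<le> c\<close> by (auto intro!: exI[of _ "\<lambda>s. c * u s"] simp: scaleR_sum_right)
  qed
  moreover have "R \<subseteq> ?C"
  proof
    fix r assume "r \<in> R"
    then have "r = (\<Sum>s\<in>R. (if s = r then 1 else 0) *\<^sub>R s)"
      using \<open>finite R\<close> by (simp add: if_distrib[of "\<lambda>c. c *\<^sub>R _"] sum.delta cong: if_cong)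
    then show "r \<in> ?C" by (auto intro!: exI[of _ "\<lambda>s. if s = r then 1 else 0"])
  qed
  ultimately have "convex_cone hull R \<subseteq> ?C" by (intro hull_minimal)
  then show ?thesis using assms(2) that by blast
qed

text \<open>The functional \<open>a\<close> exposes the ray spanned by \<open>r\<close>.\<close>
lemma exposed_ray_image:
  fixes R :: "'a::euclidean_space set"
  assumes "finite R" "0 \<notin> R" "orthogonal_transformation g"
    and g: "g ` (convex_cone hull R) = convex_cone hull R"
    and r: "r \<in> R" "a \<bullet> r = 0" and a: "\<And>s. s \<in> R \<Longrightarrow> s \<noteq> r \<Longrightarrow> 0 < a \<bullet> s"
  obtains s c where "s \<in> R" "0 < c" "g r = c *\<^sub>R s"
proof -
  let ?P = "convex_cone hull R"
  let ?h = "inv_into UNIV g"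
  have "inj g" "surj g" and lin: "linear g" "linear ?h"
    using assms(3) by (auto simp: orthogonal_transformation_inj orthogonal_transformation_surj
        orthogonal_transformation_linear orthogonal_transformation_inv)
  \<comment> \<open>In a nonnegative combination of generators annihilated by \<open>a\<close>,
    every generator other than \<open>r\<close> has coefficient 0.\<close>
  have face: "0 \<le> a \<bullet> y \<and> (a \<bullet> y = 0 \<longrightarrow> (\<exists>c\<ge>0. y = c *\<^sub>R r))" if y: "y \<in> ?P" for y
  proof -
    obtain u where u: "\<And>s. s \<in> R \<Longrightarrow> 0 \<le> u s" "y = (\<Sum>s\<in>R. u s *\<^sub>R s)"
      using convex_cone_hull_finite_sum[OF \<open>finite R\<close> y] by blast
    have ay: "a \<bullet> y = (\<Sum>s\<in>R. u s * (a \<bullet> s))" by (simp add: u inner_sum_right)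
    have nn: "0 \<le> u s * (a \<bullet> s)" if "s \<in> R" for s
      using u(1)[OF that] a[OF that] r(2) by (cases "s = r") auto
    have "\<exists>c\<ge>0. y = c *\<^sub>R r" if "a \<bullet> y = 0"
    proof -
      have "u s = 0" if "s \<in> R" "s \<noteq> r" for s
        using \<open>a \<bullet> y = 0\<close> nn that a[OF that] \<open>finite R\<close>
        by (auto simp: ay sum_nonneg_eq_0_iff)
      then have "y = (\<Sum>s\<in>{r}. u s *\<^sub>R s)"
        unfolding u(2) using r(1) \<open>finite R\<close> by (intro sum.mono_neutral_right) auto
      then show ?thesis using u(1)[OF r(1)] by auto
    qed
    then show ?thesis using nn by (auto simp: ay intro!: sum_nonneg)
  qed
  have "g r \<in> ?P" using g r(1) by (metis hull_inc imageI)
  then obtain u where u: "\<And>s. s \<in> R \<Longrightarrow> 0 \<le> u s" "g r = (\<Sum>s\<in>R. u s *\<^sub>R s)"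
    using convex_cone_hull_finite_sum[OF \<open>finite R\<close>] by blast
  have hP: "?h s \<in> ?P" if "s \<in> R" for s
  proof -
    have "s \<in> g ` ?P" using that by (simp add: g hull_inc)
    then show ?thesis using \<open>inj g\<close> by auto
  qed
  \<comment> \<open>Pulling the expansion of \<open>g r\<close> back by the inverse expands
    \<open>r\<close> in vectors of the cone. Since \<open>a\<close> vanishes on \<open>r\<close> and
    is nonnegative on the cone, each vector with nonzero coefficient lies on the ray of
    \<open>r\<close>.\<close>
  have "r = ?h (g r)" using \<open>inj g\<close> by simp
  also have "\<dots> = (\<Sum>s\<in>R. u s *\<^sub>R ?h s)"
    unfolding u(2) using lin(2) by (simp add: linear_sum linear_cmul)
  finally have req: "r = (\<Sum>s\<in>R. u s *\<^sub>R ?h s)" .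
  have "r \<noteq> 0" using r assms by auto
  have "\<exists>s\<in>R. u s \<noteq> 0"
  proof (rule ccontr)
    assume "\<not> ?thesis"
    then have "(\<Sum>s\<in>R. u s *\<^sub>R ?h s) = 0" by (intro sum.neutral) auto
    with req have "r = 0" by (rule trans)
    with \<open>r \<noteq> 0\<close> show False by contradiction
  qed
  then obtain s where s: "s \<in> R" "u s \<noteq> 0" by blast
  have "a \<bullet> r = a \<bullet> (\<Sum>s\<in>R. u s *\<^sub>R ?h s)" using req by (rule arg_cong)
  then have "0 = (\<Sum>s\<in>R. u s * (a \<bullet> ?h s))"
    by (simp add: r(2) inner_sum_right)
  moreover have "0 \<le> u s * (a \<bullet> ?h s)" if "s \<in> R" for s
    using u(1)[OF that] face[OF hP[OF that]] by simp
  ultimately have "u s * (a \<bullet> ?h s) = 0"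
    using \<open>finite R\<close> s by (auto simp: sum_nonneg_eq_0_iff)
  then obtain c where c: "0 \<le> c" "?h s = c *\<^sub>R r" using face[OF hP] s by auto
  have "s = g (?h s)" using \<open>surj g\<close> by (simp add: surj_f_inv_f)
  then have sg: "s = c *\<^sub>R g r" using lin(1) c(2) by (simp add: linear_cmul)
  with s(1) assms(2) have "c \<noteq> 0" by auto
  with sg c(1) show thesis by (intro that[of s "1 / c"] s(1)) auto
qed

lemma cut_symmetry_image:
  fixes S :: "('n::card2) set"
  assumes g: "g \<in> carrier (symmetry_group cut_cone)" and S: "cut S \<noteq> 0"
  obtains T c where "cut T \<noteq> 0" "0 < c" "g (cut S) = c *\<^sub>R cut T"
proof -
  let ?R = "{cut S | S :: 'n set. cut S \<noteq> 0}"
  \<comment> \<open>The functional counts the edges of a cut that \<open>S\<close> does not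
    separate. It vanishes on \<open>cut T\<close> only if every edge separated by \<open>T\<close>
    is separated by \<open>S\<close>.\<close>
  define a :: "real ^ 'n edge" where "a = (\<chi> e. 1 - cut S $ e)"
  have "?R \<subseteq> range cut" by auto
  then have "finite ?R" by (rule finite_subset) simp
  have cut01: "cut T $ e = 0 \<or> cut T $ e = 1" for T :: "'n set" and e by (simp add: cut_def)
  have a: "0 < a \<bullet> cut T" if T: "cut T \<noteq> 0" "cut T \<noteq> cut S" for T
  proof (rule ccontr)
    have nn: "0 \<le> a $ e * cut T $ e" for e
      using cut01[of S e] cut01[of T e] by (auto simp: a_def)
    assume "\<not> 0 < a \<bullet> cut T"
    then have "a \<bullet> cut T = 0" using nn by (simp add: inner_vec_def sum_nonneg order_antisym not_less)
    then have "a $ e * cut T $ e = 0" for e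
      using nn by (simp add: inner_vec_def sum_nonneg_eq_0_iff)
    then have le: "cut T $ e = 1 \<Longrightarrow> cut S $ e = 1" for e
      using cut01[of S e] by (metis a_def diff_zero mult_cancel_right1 vec_lambda_beta zero_neq_one)
    have sub: "(i \<in> T) \<noteq> (j \<in> T) \<Longrightarrow> (i \<in> S) \<noteq> (j \<in> S)" for i j
    proof -
      assume ij: "(i \<in> T) \<noteq> (j \<in> T)"
      then have "i \<noteq> j" by auto
      then have "coord (cut T) i j = 1" using ij by (auto simp: coord_cut)
      then have "coord (cut S) i j = 1" using le by (simp add: coord_def)
      then show ?thesis using \<open>i \<noteq> j\<close> by (auto simp: coord_cut split: if_splits)
    qed
    obtain i j where "i \<in> T" "j \<notin> T" using T(1) by (auto simp: cut_eq_0_iff)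
    \<comment> \<open>\<open>T\<close> separates \<open>k\<close> from \<open>i\<close> or from
      \<open>j\<close>, hence so does \<open>S\<close>; and \<open>S\<close> separates
      \<open>i\<close> from \<open>j\<close>. This fixes the side of \<open>k\<close> in
      \<open>S\<close>.\<close>
    then have "k \<in> T \<longleftrightarrow> (k \<in> S \<longleftrightarrow> i \<in> S)" for k using sub[of i k] sub[of k j] sub[of i j] by metis
    then have "T = S \<or> T = - S" by (cases "i \<in> S") auto
    then show False using T(2) by (simp add: cut_eq_iff)
  qed
  have "a \<bullet> cut S = 0"
  proof -
    have "a $ e * cut S $ e = 0" for e using cut01[of S e] by (auto simp: a_def)
    then show ?thesis unfolding inner_vec_def inner_real_def by (intro sum.neutral) blast
  qed
  then obtain s c where "s \<in> ?R" "0 < c" "g (cut S) = c *\<^sub>R s"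
    using exposed_ray_image[of ?R g "cut S" a] a g S \<open>finite ?R\<close>
    by (auto simp: symmetry_group_carrier cut_cone_def)
  then show thesis using that by auto
qed

text \<open>Here \<open>a\<close>, \<open>b\<close>, \<open>c\<close> are the sizes of
  \<open>S \<inter> T\<close>, \<open>S - T\<close>, \<open>T - S\<close>, with nothing outside the
  union; the equation says that the cosine is 1 / (n - 1). After cancelling \<open>b * c\<close>,
  each factor on the left is at least its counterpart on the right, with excess a multiple of
  \<open>c - 1\<close> or \<open>b - 1\<close>, so both excesses vanish.\<close>

lemma cut_cos_bound_3:
  fixes a b c :: real
  assumes "1 \<le> a" "1 \<le> b" "1 \<le> c"
    and "(a + b + c - 1)\<^sup>2 * (b * c)\<^sup>2 = (a + b) * c * ((a + c) * b)"
  shows "b = 1 \<and> c = 1"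
proof -
  let ?m = "a + b + c - 1"
  have "(b * c) * (?m\<^sup>2 * (b * c)) = (b * c) * ((a + b) * (a + c))"
    using assms(4) by (simp add: power2_eq_square algebra_simps)
  then have "?m\<^sup>2 * (b * c) = (a + b) * (a + c)"
    using assms mult_left_cancel[of "b * c"] by auto
  then have eq: "(?m * c) * (?m * b) = (a + b) * (a + c)"
    by (simp add: power2_eq_square mult_ac)
  have c: "?m * c - (a + b) = (a + b + c) * (c - 1)" and b: "?m * b - (a + c) = (a + b + c) * (b - 1)"
    by (simp_all add: algebra_simps)
  have "0 \<le> (a + b + c) * (c - 1)" "0 \<le> (a + b + c) * (b - 1)" using assms by auto
  then have le: "a + b \<le> ?m * c" "a + c \<le> ?m * b" using b c by linarith+
  have "?m * c = a + b \<and> ?m * b = a + c"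
  proof (rule ccontr)
    assume "\<not> ?thesis"
    then have "a + b < ?m * c \<or> a + c < ?m * b" using le by linarith
    then have "(a + b) * (a + c) < (?m * c) * (?m * b)"
    proof
      assume "a + b < ?m * c"
      then show ?thesis using le assms by (intro mult_less_le_imp_less) auto
    next
      assume "a + c < ?m * b"
      then show ?thesis using le assms by (intro mult_le_less_imp_less) auto
    qed
    then show False using eq by simp
  qed
  then show ?thesis using b c assms by auto
qed

text \<open>When all four parts are nonempty the cosine strictly exceeds 1 / (n - 1). Each product
  of norm factors is the inner product \<open>?X\<close> plus two more terms; as every part is at
  most n - 3, these terms contribute at most \<open>(?m - 2) * ?X\<close>.\<close>

lemma cut_cos_bound_4:
  fixes a b c d :: real
  assumes "1 \<le> a" "1 \<le> b" "1 \<le> c" "1 \<le> d"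
  shows "(a + b) * (c + d) * ((a + c) * (b + d)) < (a + b + c + d - 1)\<^sup>2 * (a * d + b * c)\<^sup>2"
proof -
  let ?m = "a + b + c + d - 1" and ?X = "a * d + b * c"
  have pos: "0 < ?X" using assms by (simp add: add_pos_pos)
  have m: "x \<le> ?m - 2" if "x \<in> {a, b, c, d}" for x using that assms by auto
  have *: "x * y \<le> (?m - 2) * (x * z)" if "y \<in> {a, b, c, d}" "1 \<le> z" "0 \<le> x" for x y z
  proof -
    have "y \<le> (?m - 2) * 1" using m[OF that(1)] by simp
    also have "\<dots> \<le> (?m - 2) * z" using that(2) assms by (intro mult_left_mono) auto
    finally have "x * y \<le> x * ((?m - 2) * z)" using that(3) by (rule mult_left_mono)
    then show ?thesis by (simp only: mult_ac)
  qed
  have "a * c + b * d \<le> (?m - 2) * ?X" "a * b + c * d \<le> (?m - 2) * ?X"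
    using *[of c d a] *[of d c b] *[of b d a] *[of d b c] assms by (simp_all add: algebra_simps)
  then have "?X + (a * c + b * d) < ?m * ?X" "?X + (a * b + c * d) < ?m * ?X"
    using pos by (simp_all add: algebra_simps)
  moreover have "0 \<le> a * c + b * d" "0 \<le> a * b + c * d" using assms by auto
  ultimately have "(?X + (a * c + b * d)) * (?X + (a * b + c * d)) < (?m * ?X) * (?m * ?X)"
    using pos by (intro mult_strict_mono) auto
  then show ?thesis by (simp add: power2_eq_square algebra_simps)
qed

text \<open>The hypothesis is the equation cos = 1 / (n - 1), squared and cleared of denominators.
  The four parts into which \<open>S\<close> and \<open>T\<close> divide the vertices reduce it to
  the two numerical bounds.\<close>

lemma cut_cos_singleton:
  fixes S T :: "('n::card2) set"
  assumes "cut S \<noteq> 0" "cut T \<noteq> 0" "cut S \<noteq> cut T"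
    and cos: "(real CARD('n) - 1)\<^sup>2 * (cut S \<bullet> cut T)\<^sup>2 = (norm (cut S))\<^sup>2 * (norm (cut T))\<^sup>2"
  shows "(card S = 1 \<or> card (- S) = 1) \<and> (card T = 1 \<or> card (- T) = 1)"
proof -
  define a b c d where abcd: "a = card (S \<inter> T)" "b = card (S - T)" "c = card (T - S)"
    "d = card (- S \<inter> - T)"
  have S: "card S = a + b" and T: "card T = a + c"
    and S': "card (- S) = c + d" and T': "card (- T) = b + d"
    unfolding abcd by (subst card_Un_disjoint[symmetric]; auto intro!: arg_cong[of _ _ card])+
  have n: "CARD('n) = a + b + c + d"
    using S S' card_Un_disjoint[of S "- S"] by simp
  have ne: "0 < a + b" "0 < c + d" "0 < a + c" "0 < b + d"
    using assms(1,2) by (auto simp flip: S T S' T' simp: card_gt_0_iff cut_eq_0_iff)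
  have "0 < b + c" "0 < a + d"
    using assms(3) by (auto simp: abcd card_gt_0_iff cut_eq_iff)
  note ne = ne this
  have eq: "(real a + real b + real c + real d - 1)\<^sup>2 * (real a * real d + real b * real c)\<^sup>2
      = (real a + real b) * (real c + real d) * ((real a + real c) * (real b + real d))"
    using cos by (simp add: cut_inner norm_cut S T S' T' n abcd[symmetric])
  \<comment> \<open>The six inequalities in \<open>ne\<close> say that any two parts have a positive
    sum, so at most one part is empty.\<close>
  consider "a = 0" | "b = 0" | "c = 0" | "d = 0" | "0 < a" "0 < b" "0 < c" "0 < d" by auto
  then show ?thesis
  proof cases
    case 1
    then show ?thesis using cut_cos_bound_3[of d c b] eq ne S T by (simp add: algebra_simps)
  next
    case 2
    then show ?thesis using cut_cos_bound_3[of c d a] eq ne S T' by (simp add: algebra_simps)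
  next
    case 3
    then show ?thesis using cut_cos_bound_3[of b a d] eq ne S' T by (simp add: algebra_simps)
  next
    case 4
    then show ?thesis using cut_cos_bound_3[of a b c] eq ne S' T' by (simp add: algebra_simps)
  next
    case 5
    then show ?thesis using cut_cos_bound_4[of a b c d] eq by simp
  qed
qed

lemma cut_singletonI:
  assumes "card S = 1 \<or> card (- S) = 1"
  obtains i where "cut S = cut {i}"
  using assms that by (metis card_1_singletonE cut_eq_iff double_complement)

lemma cut_singleton_inner:
  "cut {i} \<bullet> cut T = (if i \<in> T then card (- T) else card T)"
proof (cases "i \<in> T")
  case True
  then have "- {i} \<inter> - T = - T" "{i} - T = {}" "{i} \<inter> T = {i}" by auto
  then show ?thesis using True by (simp add: cut_inner)
next
  case False
  then have "{i} - T = {i}" "{i} \<inter> T = {}" "T - {i} = T" by auto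
  then show ?thesis using False by (simp add: cut_inner)
qed

text \<open>Cuts of two distinct single vertices have cosine 1 / (n - 1). Their images are positive
  multiples of cuts with the same cosine, so these are again cuts of single vertices, and equality
  of norms forces the multiples to be 1.\<close>

lemma cut_symmetry_singleton:
  fixes g :: "real ^ ('n::card2) edge \<Rightarrow> real ^ 'n edge"
  assumes n: "3 \<le> CARD('n)" and g: "g \<in> carrier (symmetry_group cut_cone)"
  obtains s where "bij s" "\<And>i. g (cut {i}) = cut {s i}"
proof -
  let ?m = "real CARD('n) - 1"
  have og: "orthogonal_transformation g" using g by (simp add: symmetry_group_carrier)
  have inner: "g x \<bullet> g y = x \<bullet> y" for x y
    using og by (simp add: orthogonal_transformation_def)
  have norm: "norm (g x) = norm x" for x using og by (rule orthogonal_transformation_norm)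
  have m: "1 < ?m" using n by simp
  have norm1: "(norm (cut {i}))\<^sup>2 = ?m" for i :: 'n
    using n by (simp add: norm_cut card_Compl of_nat_diff)
  have nz: "cut {i} \<noteq> 0" for i :: 'n using norm1[of i] m by auto
  have "\<exists>j. g (cut {i}) = cut {j}" for i
  proof -
    have "UNIV \<noteq> {i}"
    proof
      assume "UNIV = {i}"
      then have "CARD('n) = card {i}" by simp
      then show False using n by simp
    qed
    \<comment> \<open>The second vertex provides a partner at the extremal cosine.\<close>
    then obtain k where "k \<noteq> i" by auto
    obtain S c where S: "cut S \<noteq> 0" "0 < c" "g (cut {i}) = c *\<^sub>R cut S"
      using cut_symmetry_image[OF g nz] .
    obtain T d where T: "cut T \<noteq> 0" "0 < d" "g (cut {k}) = d *\<^sub>R cut T"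
      using cut_symmetry_image[OF g nz] .
    have "cut {i} \<bullet> cut {k} = 1" using \<open>k \<noteq> i\<close> by (simp add: cut_singleton_inner)
    then have cd: "c * d * (cut S \<bullet> cut T) = 1"
      using inner[of "cut {i}" "cut {k}"] S T by (simp add: mult_ac)
    have cS: "c\<^sup>2 * (norm (cut S))\<^sup>2 = ?m"
      using norm1[of i] unfolding norm[of "cut {i}", symmetric] S(3) by (simp add: power_mult_distrib)
    have dT: "d\<^sup>2 * (norm (cut T))\<^sup>2 = ?m"
      using norm1[of k] unfolding norm[of "cut {k}", symmetric] T(3) by (simp add: power_mult_distrib)
    \<comment> \<open>The scaling factors are carried along and cancelled, since the cosine does not
      depend on them.\<close>
    have "(c * d)\<^sup>2 * (?m\<^sup>2 * (cut S \<bullet> cut T)\<^sup>2) = ?m\<^sup>2 * (c * d * (cut S \<bullet> cut T))\<^sup>2"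
      by (simp add: power_mult_distrib)
    also have "\<dots> = (c\<^sup>2 * (norm (cut S))\<^sup>2) * (d\<^sup>2 * (norm (cut T))\<^sup>2)"
      unfolding cd cS dT by (simp add: power2_eq_square)
    finally have "(c * d)\<^sup>2 * (?m\<^sup>2 * (cut S \<bullet> cut T)\<^sup>2)
        = (c * d)\<^sup>2 * ((norm (cut S))\<^sup>2 * (norm (cut T))\<^sup>2)"
      by (simp add: power_mult_distrib)
    then have eq: "?m\<^sup>2 * (cut S \<bullet> cut T)\<^sup>2 = (norm (cut S))\<^sup>2 * (norm (cut T))\<^sup>2"
      using S(2) T(2) by simp
    \<comment> \<open>Equal cuts would have cosine 1, whereas \<open>?m\<close> exceeds 1.\<close>
    have "cut S \<noteq> cut T"
    proof
      assume "cut S = cut T"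
      then have "?m\<^sup>2 * ((norm (cut S))\<^sup>2)\<^sup>2 = ((norm (cut S))\<^sup>2)\<^sup>2"
        using eq by (simp only: dot_square_norm power2_eq_square[of "(norm (cut T))\<^sup>2"])
      then have "?m\<^sup>2 = 1" using S(1) by simp
      then show False using m by (simp add: power2_eq_1_iff)
    qed
    then obtain j where j: "cut S = cut {j}"
      using cut_cos_singleton[OF S(1) T(1) _ eq] cut_singletonI by metis
    then have "c\<^sup>2 = 1" using cS norm1[of j] m by simp
    then have "c = 1" using S(2) by (simp add: power2_eq_1_iff)
    then show ?thesis using S(3) j by auto
  qed
  then obtain s where s: "\<And>i. g (cut {i}) = cut {s i}" by metis
  have "inj g" using og by (rule orthogonal_transformation_inj)
  have "inj s"
  proof (rule injI)
    fix i j assume "s i = s j"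
    then have "g (cut {i}) = g (cut {j})" by (simp add: s)
    then show "i = j" using \<open>inj g\<close> by (simp add: inj_eq cut_singleton_eq_iff n)
  qed
  then have "bij s" by (simp add: bij_def finite_UNIV_inj_surj)
  then show thesis using s that by blast
qed

lemma cut_sum_edge_vec:
  assumes "i \<noteq> j"
  shows "cut {i} + cut {j} - cut {i, j} = 2 *\<^sub>R edge_vec i j"
  using assms by (intro coord_ext) (auto simp: coord_cut coord_edge_vec doubleton_eq_iff)

text \<open>The inner product of \<open>cut {i, j}\<close> with \<open>cut {l}\<close> is n - 2 for
  \<open>l\<close> in the pair and 2 otherwise. These values differ for n \<ge> 5, so the preserved
  inner products reveal the bipartition of the image.\<close>

lemma cut_symmetry_pair:
  fixes g :: "real ^ ('n::card2) edge \<Rightarrow> real ^ 'n edge"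
  assumes n: "5 \<le> CARD('n)" and g: "g \<in> carrier (symmetry_group cut_cone)"
    and s: "bij s" "\<And>i. g (cut {i}) = cut {s i}" and "i \<noteq> j"
  shows "g (cut {i, j}) = cut {s i, s j}"
proof -
  have inner: "g x \<bullet> g y = x \<bullet> y" for x y
    using g by (simp add: symmetry_group_carrier orthogonal_transformation_def)
  have inj: "s k = s l \<longleftrightarrow> k = l" for k l using s(1) by (simp add: bij_def inj_eq)
  have card2: "card {k, l} = 2" "card (- {k, l}) = CARD('n) - 2" if "k \<noteq> l" for k l :: 'n
    using that by (simp_all add: card_Compl)
  have "card {i, j} < CARD('n)" using n card2[OF \<open>i \<noteq> j\<close>] by simp
  then have "{i, j} \<noteq> UNIV" by (metis less_irrefl)
  then obtain k where k: "k \<notin> {i, j}" by auto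
  have "cut {i, j} \<noteq> 0" using k by (auto simp: cut_eq_0_iff)
  then obtain T c where T: "0 < c" "g (cut {i, j}) = c *\<^sub>R cut T"
    using cut_symmetry_image[OF g] by metis
  have *: "c * (if s l \<in> T then card (- T) else card T)
      = (if l \<in> {i, j} then real CARD('n) - 2 else 2)" for l
  proof -
    have "cut {s l} \<bullet> (c *\<^sub>R cut T) = cut {l} \<bullet> cut {i, j}"
      using inner[of "cut {l}" "cut {i, j}"] by (simp add: s T)
    then show ?thesis
      using card2[OF \<open>i \<noteq> j\<close>] n by (auto simp: cut_singleton_inner of_nat_diff)
  qed
  \<comment> \<open>Vertices on the same side of \<open>T\<close> give the same value in the
    equation \<open>*\<close>. The vertex \<open>k\<close> supplies the value 2, which shows that
    the two sides have different sizes.\<close>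
  have same: "(s l \<in> T \<longleftrightarrow> s i \<in> T) \<longleftrightarrow> l \<in> {i, j}" for l
    using *[of l] *[of i] *[of k] k n by (auto split: if_splits)
  have sij: "s l \<in> {s i, s j} \<longleftrightarrow> l \<in> {i, j}" for l by (auto simp: inj)
  have "cut T = cut {s i, s j} \<and> c = 1"
  proof (cases "s i \<in> T")
    case True
    then have "x \<in> T \<longleftrightarrow> x \<in> {s i, s j}" for x
      using same sij bij_is_surj[OF s(1)] by (metis surjD)
    then have "T = {s i, s j}" by blast
    then show ?thesis using *[of k] k card2[of "s i" "s j"] \<open>i \<noteq> j\<close> by (auto simp: inj)
  next
    case False
    then have "x \<in> T \<longleftrightarrow> x \<in> - {s i, s j}" for x
      using same sij bij_is_surj[OF s(1)] by (metis surjD ComplD ComplI)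
    then have "T = - {s i, s j}" by blast
    then show ?thesis
      using *[of k] k card2[of "s i" "s j"] \<open>i \<noteq> j\<close> by (auto simp: inj cut_eq_iff)
  qed
  then show ?thesis using T by simp
qed

lemma cut_symmetry_group:
  assumes n: "5 \<le> CARD('n::card2)"
  shows "carrier (symmetry_group (cut_cone :: (real ^ 'n edge) set)) = vperm ` {s. bij s}"
proof
  show "vperm ` {s. bij s} \<subseteq> carrier (symmetry_group (cut_cone :: (real ^ 'n edge) set))"
    using vperm_symmetry_cut by blast
  show "carrier (symmetry_group (cut_cone :: (real ^ 'n edge) set)) \<subseteq> vperm ` {s. bij s}"
  proof
    fix g assume g: "g \<in> carrier (symmetry_group (cut_cone :: (real ^ 'n edge) set))"
    have "3 \<le> CARD('n)" using n by simp
    then obtain s where s: "bij s" "\<And>i. g (cut {i}) = cut {s i}"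
      using cut_symmetry_singleton g by blast
    have lin: "linear g"
      using g by (simp add: symmetry_group_carrier orthogonal_transformation_linear)
    have "g = vperm s"
    proof (rule linear_eq_edge_vec[OF lin linear_vperm])
      fix i j :: 'n assume ij: "i \<noteq> j"
      then have sij: "s i \<noteq> s j" using s(1) by (metis bij_pointE)
      have "2 *\<^sub>R g (edge_vec i j) = g (cut {i} + cut {j} - cut {i, j})"
        by (simp add: cut_sum_edge_vec ij lin linear_cmul)
      also have "\<dots> = 2 *\<^sub>R edge_vec (s i) (s j)"
        using cut_symmetry_pair[OF n g s ij]
        by (simp add: lin linear_add linear_diff s cut_sum_edge_vec[symmetric] sij)
      finally show "g (edge_vec i j) = vperm s (edge_vec i j)"
        by (simp add: vperm_edge_vec s ij)
    qed
    then show "g \<in> vperm ` {s. bij s}" using s(1) by blast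
  qed
qed

subsection \<open>The metric cone\<close>

text \<open>Strict inequalities survive small steps. The filter form allows finitely many
  constraints to be satisfied at once.\<close>

lemma eventually_small_step:
  fixes x d w :: "'a::real_inner"
  assumes "w \<bullet> x < 0"
  shows "\<forall>\<^sub>F r in at_right (0::real). w \<bullet> (x + r *\<^sub>R d) < 0"
proof -
  have "((\<lambda>r. w \<bullet> (x + r *\<^sub>R d)) \<longlongrightarrow> w \<bullet> (x + 0 *\<^sub>R d)) (at_right (0::real))"
    by (intro tendsto_intros)
  then show ?thesis using assms by (auto dest: order_tendstoD(2))
qed

lemma facet_normals_image:
  fixes F :: "'a::euclidean_space set"
  assumes "finite F" and g: "orthogonal_transformation g" "g ` P = P"
    and P: "P = {x. \<forall>v\<in>F. v \<bullet> x \<le> 0}"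
    and norm: "\<And>v. v \<in> F \<Longrightarrow> norm v = r" and "0 < r"
    and facet: "\<And>v. v \<in> F \<Longrightarrow> \<exists>x. v \<bullet> x = 0 \<and> (\<forall>w\<in>F. w \<noteq> v \<longrightarrow> w \<bullet> x < 0)"
  shows "g ` F = F"
proof -
  have inner: "g x \<bullet> g y = x \<bullet> y" for x y
    using g by (simp add: orthogonal_transformation_def)
  have gnorm: "norm (g x) = norm x" for x using g(1) by (rule orthogonal_transformation_norm)
  have gP: "\<forall>u\<in>F. g u \<bullet> x \<le> 0" if "x \<in> P" for x
  proof -
    obtain y where "y \<in> P" "x = g y" using \<open>x \<in> P\<close> g(2) by blast
    then show ?thesis using P by (simp add: inner)
  qed
  have Pg: "x \<in> P" if "\<forall>u\<in>F. g u \<bullet> x \<le> 0" for x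
  proof -
    obtain y where y: "x = g y" using orthogonal_transformation_surj[OF g(1)] by (metis surjD)
    with that have "y \<in> P" using P by (simp add: inner)
    then show ?thesis using y g(2) by blast
  qed
  have "F \<subseteq> g ` F"
  proof
    fix v assume v: "v \<in> F"
    have vv: "v \<bullet> v = r\<^sup>2" using norm[OF v] by (simp add: power2_norm_eq_inner[symmetric])
    obtain x where x: "v \<bullet> x = 0" "\<And>w. w \<in> F \<Longrightarrow> w \<noteq> v \<Longrightarrow> w \<bullet> x < 0"
      using facet[OF v] by blast
    have "w \<bullet> x \<le> 0" if "w \<in> F" for w using x that by (cases "w = v") (auto intro: less_imp_le)
    then have "x \<in> P" unfolding P by blast
    \<comment> \<open>Otherwise a small step from \<open>x\<close> along \<open>v\<close> would stay
      in \<open>P\<close> and violate the constraint of \<open>v\<close>.\<close>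
    have "\<exists>u\<in>F. g u \<bullet> x = 0"
    proof (rule ccontr)
      assume "\<not> ?thesis"
      then have "\<forall>u\<in>F. g u \<bullet> x < 0" using gP[OF \<open>x \<in> P\<close>] by (auto simp: less_le)
      then have "\<forall>\<^sub>F e in at_right 0. \<forall>u\<in>F. g u \<bullet> (x + e *\<^sub>R v) < 0"
        using \<open>finite F\<close> by (intro eventually_ball_finite) (auto intro: eventually_small_step)
      moreover have "\<forall>\<^sub>F e in at_right (0::real). 0 < e" by (simp add: eventually_at_right_less)
      ultimately obtain e where e: "0 < e" "\<forall>u\<in>F. g u \<bullet> (x + e *\<^sub>R v) < 0"
        using eventually_happens'[OF trivial_limit_at_right_real eventually_conj] by blast
      then have "x + e *\<^sub>R v \<in> P" by (intro Pg) (auto simp: less_imp_le)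
      then have "v \<bullet> (x + e *\<^sub>R v) \<le> 0" using v P by blast
      then have "e * r\<^sup>2 \<le> 0" by (simp add: inner_add_right x vv)
      then show False using e(1) \<open>0 < r\<close> by (simp add: mult_le_0_iff)
    qed
    then obtain u where u: "u \<in> F" "g u \<bullet> x = 0" by blast
    \<comment> \<open>Near \<open>x\<close> only the constraint of \<open>v\<close> matters, so a
      small step in the direction \<open>d\<close> stays in \<open>P\<close>.\<close>
    have half: "g u \<bullet> d \<le> 0" if "v \<bullet> d \<le> 0" for d
    proof -
      have "\<forall>\<^sub>F e in at_right 0. \<forall>w\<in>F - {v}. w \<bullet> (x + e *\<^sub>R d) < 0"
        using \<open>finite F\<close> x by (intro eventually_ball_finite) (auto intro: eventually_small_step)
      moreover have "\<forall>\<^sub>F e in at_right (0::real). 0 < e" by (simp add: eventually_at_right_less)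
      ultimately obtain e where e: "0 < e" "\<forall>w\<in>F - {v}. w \<bullet> (x + e *\<^sub>R d) < 0"
        using eventually_happens'[OF trivial_limit_at_right_real eventually_conj] by blast
      have "v \<bullet> (x + e *\<^sub>R d) \<le> 0"
        using e(1) that by (simp add: inner_add_right x mult_nonneg_nonpos)
      with e(2) have "x + e *\<^sub>R d \<in> P" unfolding P by (auto intro: less_imp_le)
      then have "g u \<bullet> (x + e *\<^sub>R d) \<le> 0" using gP u(1) by blast
      then show ?thesis using e(1) u(2) by (simp add: inner_add_right mult_le_0_iff)
    qed
    have uu: "g u \<bullet> g u = r\<^sup>2" using norm[OF u(1)] by (simp add: gnorm power2_norm_eq_inner[symmetric])
    \<comment> \<open>Cauchy-Schwarz makes \<open>g u - v\<close> an admissible direction for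
      \<open>half\<close>. As both vectors have length \<open>r\<close>, the resulting inequality
      bounds the squared distance between them by 0.\<close>
    have "v \<bullet> g u \<le> r\<^sup>2"
      using Cauchy_Schwarz_ineq2[of v "g u"] norm[OF v] norm[OF u(1)]
      by (simp add: gnorm power2_eq_square)
    then have "v \<bullet> (g u - v) \<le> 0" by (simp add: inner_diff_right vv)
    then have "g u \<bullet> (g u - v) \<le> 0" by (rule half)
    then have "(g u - v) \<bullet> (g u - v) \<le> 0"
      using uu vv by (simp add: inner_diff_left inner_diff_right inner_commute)
    then have "g u = v" using inner_ge_zero[of "g u - v"] by (metis eq_iff_diff_eq_0 inner_eq_zero_iff order_antisym)
    then show "v \<in> g ` F" using u(1) by blast
  qed
  moreover have "card (g ` F) = card F"
    using orthogonal_transformation_inj[OF g(1)] by (simp add: card_image inj_on_subset)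
  ultimately show ?thesis using \<open>finite F\<close> by (metis card_subset_eq finite_imageI)
qed

section \<open>Triangle inequalities and their normals\<close>

definition tri :: "'n::card2 \<Rightarrow> 'n \<Rightarrow> 'n \<Rightarrow> real ^ 'n edge"
  where "tri i j k = edge_vec i j - edge_vec i k - edge_vec j k"

definition triangle_normals :: "(real ^ ('n::card2) edge) set"
  where "triangle_normals = {tri i j k | i j k. i \<noteq> j \<and> i \<noteq> k \<and> j \<noteq> k}"

lemma tri_sym: "tri i j k = tri j i k"
  by (simp add: tri_def edge_vec_sym)

lemma inner_tri: "tri i j k \<bullet> x = coord x i j - coord x i k - coord x j k"
  by (simp add: tri_def inner_diff_left)

lemma coord_tri:
  assumes "p \<noteq> q" "i \<noteq> j" "i \<noteq> k" "j \<noteq> k"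
  shows "coord (tri i j k) p q = (if {p, q} = {i, j} then 1
    else if {p, q} = {i, k} \<or> {p, q} = {j, k} then - 1 else 0)"
  using assms by (auto simp: tri_def coord_edge_vec doubleton_eq_iff)

lemma coord_tri_eq_0_iff:
  assumes "p \<noteq> q" "i \<noteq> j" "i \<noteq> k" "j \<noteq> k"
  shows "coord (tri i j k) p q = 0 \<longleftrightarrow> \<not> {p, q} \<subseteq> {i, j, k}"
  using assms by (auto simp: coord_tri doubleton_eq_iff)

lemma coord_tri_cases:
  assumes "p \<noteq> q" "i \<noteq> j" "i \<noteq> k" "j \<noteq> k"
  shows "coord (tri i j k) p q \<in> {- 1, 0, 1}"
  using assms by (auto simp: coord_tri)

lemma finite_triangle_normals: "finite (triangle_normals :: (real ^ ('n::card2) edge) set)"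
proof -
  have "triangle_normals \<subseteq> (\<Union>i. \<Union>j. \<Union>k :: 'n. {tri i j k})"
    by (auto simp: triangle_normals_def)
  then show ?thesis by (rule finite_subset) simp
qed

lemma met_cone_eq: "met_cone = {x. \<forall>v\<in>triangle_normals. v \<bullet> x \<le> 0}"
  by (fastforce simp: met_cone_def triangle_normals_def inner_tri)

lemma tri_inner_self:
  assumes "i \<noteq> j" "i \<noteq> k" "j \<noteq> k"
  shows "tri i j k \<bullet> tri i j k = 3"
  using assms by (simp add: inner_tri coord_tri doubleton_eq_iff)

lemma triangle_facet:
  fixes v :: "real ^ ('n::card2) edge"
  assumes "v \<in> triangle_normals"
  shows "\<exists>x. v \<bullet> x = 0 \<and> (\<forall>w\<in>triangle_normals. w \<noteq> v \<longrightarrow> w \<bullet> x < 0)"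
proof -
  obtain i j k where v: "v = tri i j k" "i \<noteq> j" "i \<noteq> k" "j \<noteq> k"
    using assms by (auto simp: triangle_normals_def)
  \<comment> \<open>\<open>x\<close> lies on the facet of \<open>v\<close> only: a different
    triangle with positive edge \<open>{i, j}\<close> gives 2 - 3 / 2 - 3 / 2, and any other
    positive edge gives at most 3 / 2 - 1 - 1.\<close>
  define x :: "real ^ 'n edge" where "x = (\<chi> e. if Rep_edge e = {i, j} then 2
      else if Rep_edge e = {i, k} \<or> Rep_edge e = {j, k} then 1 else 3 / 2)"
  have x: "coord x p q = (if {p, q} = {i, j} then 2
      else if {p, q} = {i, k} \<or> {p, q} = {j, k} then 1 else 3 / 2)" if "p \<noteq> q" for p q
    using that by (simp add: coord_def x_def)
  have "v \<bullet> x = 0" using v by (simp add: inner_tri x doubleton_eq_iff)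
  moreover have "w \<bullet> x < 0" if w: "w \<in> triangle_normals" "w \<noteq> v" for w
  proof -
    obtain p q r where pqr: "w = tri p q r" "p \<noteq> q" "p \<noteq> r" "q \<noteq> r"
      using w by (auto simp: triangle_normals_def)
    have ge: "1 \<le> coord x p r" "1 \<le> coord x q r" using pqr by (auto simp: x)
    show ?thesis
    proof (cases "{p, q} = {i, j}")
      case True
      then have "r \<noteq> k" using pqr v w(2) by (auto simp: doubleton_eq_iff tri_sym)
      then have "coord x p r = 3 / 2" "coord x q r = 3 / 2"
        using True pqr v by (auto simp: x doubleton_eq_iff)
      then show ?thesis using True pqr by (simp add: inner_tri x)
    next
      case False
      then have "coord x p q \<le> 3 / 2" using pqr by (simp add: x)
      then show ?thesis using ge pqr(1) by (simp add: inner_tri)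
    qed
  qed
  ultimately show ?thesis by blast
qed

lemma met_symmetry_normals:
  assumes "g \<in> carrier (symmetry_group met_cone)"
  shows "g ` triangle_normals = triangle_normals"
proof (rule facet_normals_image[OF finite_triangle_normals _ _ met_cone_eq])
  show "orthogonal_transformation g" "g ` met_cone = met_cone"
    using assms by (auto simp: symmetry_group_carrier)
  show "norm v = sqrt 3" if "v \<in> triangle_normals" for v
    using that tri_inner_self by (auto simp: triangle_normals_def norm_eq_sqrt_inner)
qed (use triangle_facet in auto)

text \<open>With at most four vertices the sums of two triangle normals supported on a 4-cycle
  would satisfy the same condition: it takes a fifth vertex to rule them out.\<close>
definition edge_sums :: "(real ^ ('n::card2) edge) set"
  where "edge_sums = {u + v | u v. u \<in> triangle_normals \<and> v \<in> triangle_normals \<and> u \<bullet> v = - 1 \<and>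
    (\<forall>t\<in>triangle_normals. t \<bullet> (u + v) \<noteq> 1 \<and> t \<bullet> (u + v) \<noteq> - 1)}"

text \<open>Two normals of a triangle on \<open>j\<close>, \<open>k\<close> and a third vertex
  cancel except on \<open>{j, k}\<close>. A normal has entries -1, 0, 1, so its inner product with
  the sum is even.\<close>

lemma edge_vec_in_edge_sums:
  assumes n: "3 \<le> CARD('n::card2)" and jk: "(j :: 'n) \<noteq> k"
  shows "- 2 *\<^sub>R edge_vec j k \<in> edge_sums"
proof -
  have "card {j, k} < CARD('n)" using n jk by simp
  then have "{j, k} \<noteq> UNIV" by (metis less_irrefl)
  then obtain i where i: "i \<noteq> j" "i \<noteq> k" by auto
  have eq: "- 2 *\<^sub>R edge_vec j k = tri i j k + tri i k j"
    by (simp add: tri_def edge_vec_sym[of k j] scaleR_2)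
  have "tri i j k \<in> triangle_normals" "tri i k j \<in> triangle_normals"
    using i jk by (auto simp: triangle_normals_def)
  moreover have "tri i j k \<bullet> tri i k j = - 1"
    using i jk by (simp add: inner_tri coord_tri doubleton_eq_iff)
  moreover have "t \<bullet> (tri i j k + tri i k j) \<noteq> 1 \<and> t \<bullet> (tri i j k + tri i k j) \<noteq> - 1"
    if t: "t \<in> triangle_normals" for t
  proof -
    obtain a b c where "t = tri a b c" "a \<noteq> b" "a \<noteq> c" "b \<noteq> c"
      using t by (auto simp: triangle_normals_def)
    then have "coord t j k \<in> {- 1, 0, 1}" using coord_tri_cases jk by blast
    then show ?thesis by (auto simp flip: eq)
  qed
  ultimately show ?thesis unfolding edge_sums_def eq by blast
qed

text \<open>Normals of different triangles with a common edge are excluded by a test normal that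
  meets their sum in a single coordinate, of value 1 or -1. Two different normals of the same
  triangle sum to -2 times a coordinate vector.\<close>

lemma edge_sums_edge_vec:
  assumes n: "5 \<le> CARD('n::card2)" and w: "w \<in> (edge_sums :: (real ^ 'n edge) set)"
  obtains p q where "p \<noteq> q" "w = - 2 *\<^sub>R edge_vec p q"
proof -
  obtain u v where uv: "w = u + v" "u \<in> triangle_normals" "v \<in> triangle_normals" "u \<bullet> v = - 1"
    and odd: "\<And>t. t \<in> triangle_normals \<Longrightarrow> t \<bullet> (u + v) \<noteq> 1 \<and> t \<bullet> (u + v) \<noteq> - 1"
    using w by (auto simp: edge_sums_def)
  obtain i j k where u: "u = tri i j k" and ijk: "i \<noteq> j" "i \<noteq> k" "j \<noteq> k"
    using uv by (auto simp: triangle_normals_def)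
  obtain a b c where v: "v = tri a b c" and abc: "a \<noteq> b" "a \<noteq> c" "b \<noteq> c"
    using uv by (auto simp: triangle_normals_def)
  have same: "{i, j, k} = {a, b, c}"
  proof (rule ccontr)
    assume ne: "{i, j, k} \<noteq> {a, b, c}"
    have sub: "{x, y} \<subseteq> {a, b, c}" if "coord v x y \<noteq> 0" "x \<noteq> y" for x y
      using that coord_tri_eq_0_iff[OF that(2) abc] by (auto simp: v)
    \<comment> \<open>A nonzero inner product forces a common edge \<open>{p, q}\<close>;
      \<open>r\<close> is the remaining vertex of the first triangle.\<close>
    obtain p q r where pqr: "{i, j, k} = {p, q, r}" "p \<noteq> q" "p \<noteq> r" "q \<noteq> r" "{p, q} \<subseteq> {a, b, c}"
    proof -
      consider "coord v i j \<noteq> 0" | "coord v i k \<noteq> 0" | "coord v j k \<noteq> 0"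
        using uv(4) by (force simp: u inner_tri)
      then show thesis
      proof cases
        case 1
        then show thesis using that[of i j k] sub ijk by blast
      next
        case 2
        then show thesis using that[of i k j] sub ijk by blast
      next
        case 3
        then show thesis using that[of j k i] sub ijk by blast
      qed
    qed
    have r: "r \<notin> {a, b, c}"
    proof
      assume "r \<in> {a, b, c}"
      then have "{p, q, r} \<subseteq> {a, b, c}" using pqr by simp
      moreover have "card {p, q, r} = card {a, b, c}" using pqr abc by simp
      ultimately have "{p, q, r} = {a, b, c}" by (simp add: card_subset_eq)
      then show False using ne pqr by simp
    qed
    have "card {r, a, b, c} < CARD('n)" using n by (simp add: card_insert_if)
    then have "{r, a, b, c} \<noteq> UNIV" by (metis less_irrefl)
    \<comment> \<open>The two triangles cover only the four vertices \<open>r\<close>,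
      \<open>a\<close>, \<open>b\<close>, \<open>c\<close>, so a fifth one is free. The triangle on
      \<open>p\<close>, \<open>r\<close>, \<open>m\<close> meets the support of \<open>u + v\<close>
      only in the edge \<open>{p, r}\<close>.\<close>
    then obtain m where m: "m \<notin> {r, a, b, c}" by auto
    then have m': "m \<notin> {i, j, k}" unfolding pqr(1) using pqr(5) by auto
    have ne': "m \<noteq> p" "m \<noteq> r" using m pqr by auto
    have "coord u p r \<noteq> 0" "coord u p m = 0" "coord u r m = 0"
      unfolding u using ijk pqr m' ne' by (simp_all add: coord_tri_eq_0_iff)
    moreover have "coord v p r = 0" "coord v p m = 0" "coord v r m = 0"
      unfolding v using abc pqr m r ne' by (simp_all add: coord_tri_eq_0_iff)
    moreover have "coord u p r \<in> {- 1, 0, 1}" unfolding u by (rule coord_tri_cases[OF pqr(3) ijk])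
    moreover have "tri p r m \<in> triangle_normals" using pqr ne' by (auto simp: triangle_normals_def)
    ultimately show False using odd[of "tri p r m"] by (auto simp: inner_tri)
  qed
  \<comment> \<open>\<open>k\<close> and \<open>c\<close> are the vertices opposite the positive
    edges. If they coincided, \<open>u\<close> and \<open>v\<close> would be equal, with inner
    product 3 instead of -1.\<close>
  have c: "c \<noteq> k"
  proof
    assume "c = k"
    then have "{a, b} = {i, j}" using same abc ijk by auto
    then have "v = u" using \<open>c = k\<close> by (auto simp: u v doubleton_eq_iff tri_sym)
    then show False using uv(4) tri_inner_self[OF ijk] by (simp add: u)
  qed
  have ab: "{a, b} = {i, j, k} - {c}" using same abc by auto
  have "c \<in> {i, j, k}" unfolding same by simp
  then have "c = i \<or> c = j" using c by simp
  then show thesis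
  proof
    assume "c = i"
    then have "{a, b} = {j, k}" unfolding ab using ijk by auto
    then have "v = tri j k i"
      unfolding v \<open>c = i\<close> doubleton_eq_iff using tri_sym[of j k i] by auto
    then have "w = - 2 *\<^sub>R edge_vec i k"
      by (simp add: uv(1) u tri_def edge_vec_sym[of j i] edge_vec_sym[of k i] scaleR_2)
    then show thesis using that ijk by blast
  next
    assume "c = j"
    then have "{a, b} = {i, k}" unfolding ab using ijk by auto
    then have "v = tri i k j"
      unfolding v \<open>c = j\<close> doubleton_eq_iff using tri_sym[of i k j] by auto
    then have "w = - 2 *\<^sub>R edge_vec j k"
      by (simp add: uv(1) u tri_def edge_vec_sym[of k j] scaleR_2)
    then show thesis using that ijk by blast
  qed
qed

text \<open>\<open>edge_sums\<close> is described by inner products and the set of normals, both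
  preserved by \<open>g\<close>, so \<open>g\<close> maps the vectors -2 times an edge vector among
  themselves.\<close>

lemma met_symmetry_edge_vec:
  fixes g :: "real ^ ('n::card2) edge \<Rightarrow> real ^ 'n edge"
  assumes n: "5 \<le> CARD('n)" and g: "g \<in> carrier (symmetry_group met_cone)" and "i \<noteq> j"
  obtains p q where "p \<noteq> q" "g (edge_vec i j) = edge_vec p q"
proof -
  have og: "orthogonal_transformation g" using g by (simp add: symmetry_group_carrier)
  then have lin: "linear g" by (rule orthogonal_transformation_linear)
  have inner: "g x \<bullet> g y = x \<bullet> y" for x y
    using og by (simp add: orthogonal_transformation_def)
  have F: "g ` triangle_normals = triangle_normals" using g by (rule met_symmetry_normals)
  have E: "g w \<in> edge_sums" if w: "w \<in> edge_sums" for w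
  proof -
    obtain u v where uv: "w = u + v" "u \<in> triangle_normals" "v \<in> triangle_normals" "u \<bullet> v = - 1"
      and odd: "\<And>t. t \<in> triangle_normals \<Longrightarrow> t \<bullet> (u + v) \<noteq> 1 \<and> t \<bullet> (u + v) \<noteq> - 1"
      using w by (auto simp: edge_sums_def)
    have gw: "g w = g u + g v" by (simp add: uv lin linear_add)
    have "t \<bullet> (g u + g v) \<noteq> 1 \<and> t \<bullet> (g u + g v) \<noteq> - 1" if "t \<in> triangle_normals" for t
    proof -
      from that have "t \<in> g ` triangle_normals" by (simp only: F)
      then obtain t' where t': "t' \<in> triangle_normals" "t = g t'" by blast
      from t'(2) have "t \<bullet> (g u + g v) = t' \<bullet> (u + v)" by (simp add: inner_add_right inner)
      then show ?thesis using odd[OF t'(1)] by simp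
    qed
    moreover have "g u \<in> triangle_normals" "g v \<in> triangle_normals" "g u \<bullet> g v = - 1"
      using uv F by (auto simp: inner)
    ultimately show ?thesis unfolding edge_sums_def gw by blast
  qed
  have "3 \<le> CARD('n)" using n by simp
  then have "g (- 2 *\<^sub>R edge_vec i j) \<in> edge_sums" using E edge_vec_in_edge_sums \<open>i \<noteq> j\<close> by blast
  then obtain p q where "p \<noteq> q" "g (- 2 *\<^sub>R edge_vec i j) = - 2 *\<^sub>R edge_vec p q"
    using edge_sums_edge_vec[OF n] by blast
  then show thesis using that lin by (simp add: linear_cmul linear_neg)
qed

text \<open>The only positive entry on the right is at \<open>x'\<close>, so \<open>x\<close> must
  equal \<open>x'\<close>. The negative terms are then compared at \<open>y\<close> and at
  \<open>z\<close>.\<close>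

lemma axis_triangle_eq:
  fixes x y z :: "'e::finite"
  assumes "axis x (1::real) - axis y 1 - axis z 1 = axis x' 1 - axis y' 1 - axis z' 1"
    "y \<noteq> z" "x' \<noteq> y'" "x' \<noteq> z'"
  shows "x = x' \<and> {y, z} = {y', z'}"
proof -
  have *: "axis x (1::real) $ e - axis y 1 $ e - axis z 1 $ e
      = axis x' 1 $ e - axis y' 1 $ e - axis z' 1 $ e" for e
    using arg_cong[OF assms(1), of "\<lambda>v. v $ e"] by simp
  have x: "x = x'" using *[of x'] assms(3,4) by (auto simp: axis_def split: if_splits)
  have "y = y' \<or> y = z'" using *[of y] x by (auto simp: axis_def split: if_splits)
  moreover have "z = y' \<or> z = z'" using *[of z] x by (auto simp: axis_def split: if_splits)
  ultimately show ?thesis using x assms(2) by auto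
qed

text \<open>The induced map \<open>f\<close> on edges is injective and takes triangles to triangles,
  so edges at a vertex go to edges at a common vertex; this vertex defines \<open>s\<close>.\<close>

lemma met_symmetry_vperm:
  fixes g :: "real ^ ('n::card2) edge \<Rightarrow> real ^ 'n edge"
  assumes n: "5 \<le> CARD('n)" and g: "g \<in> carrier (symmetry_group met_cone)"
  obtains s where "bij s" "g = vperm s"
proof -
  have og: "orthogonal_transformation g" using g by (simp add: symmetry_group_carrier)
  then have lin: "linear g" by (rule orthogonal_transformation_linear)
  have "inj g" using og by (rule orthogonal_transformation_inj)
  define f where
    "f i j = (SOME D. \<exists>p q. D = {p, q} \<and> p \<noteq> q \<and> g (edge_vec i j) = edge_vec p q)" for i j
  have f: "\<exists>p q. f i j = {p, q} \<and> p \<noteq> q \<and> g (edge_vec i j) = edge_vec p q" if ij: "i \<noteq> j" for i j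
  proof -
    obtain p q where "p \<noteq> q" "g (edge_vec i j) = edge_vec p q"
      by (rule met_symmetry_edge_vec[OF n g ij])
    then have "\<exists>D p q. D = {p, q} \<and> p \<noteq> q \<and> g (edge_vec i j) = edge_vec p q" by blast
    then show ?thesis unfolding f_def by (rule someI_ex)
  qed
  have f_inj: "{i, j} = {k, l}" if "f i j = f k l" "i \<noteq> j" "k \<noteq> l" for i j k l
  proof -
    have "g (edge_vec i j) = g (edge_vec k l)"
      using f[OF that(2)] f[OF that(3)] that(1) edge_vec_eq_iff by metis
    then show ?thesis using \<open>inj g\<close> that by (simp add: inj_eq edge_vec_eq_iff)
  qed
  have f_sym: "f i j = f j i" if "i \<noteq> j" for i j
    using f[OF that] f[OF that[symmetric]] by (metis edge_vec_eq_iff edge_vec_sym)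
  have f_tri: "\<exists>a b c. f i j = {a, b} \<and> f i k = {a, c} \<and> f j k = {b, c} \<and> a \<noteq> b \<and> a \<noteq> c \<and> b \<noteq> c"
    if ijk: "i \<noteq> j" "i \<noteq> k" "j \<noteq> k" for i j k
  proof -
    have "tri i j k \<in> triangle_normals" using ijk by (auto simp: triangle_normals_def)
    then have "g (tri i j k) \<in> triangle_normals" using met_symmetry_normals[OF g] by blast
    then obtain a b c where abc: "g (tri i j k) = tri a b c" "a \<noteq> b" "a \<noteq> c" "b \<noteq> c"
      by (auto simp: triangle_normals_def)
    have ev: "g (edge_vec x y) = axis (Abs_edge (f x y)) 1 \<and> Rep_edge (Abs_edge (f x y)) = f x y"
      if xy: "x \<noteq> y" for x y
    proof -
      obtain p q where "f x y = {p, q}" "p \<noteq> q" "g (edge_vec x y) = edge_vec p q"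
        using f[OF xy] by blast
      then show ?thesis by (simp add: edge_vec_def)
    qed
    have "axis (Abs_edge (f i j)) 1 - axis (Abs_edge (f i k)) 1 - axis (Abs_edge (f j k)) (1::real)
        = axis (Abs_edge {a, b}) 1 - axis (Abs_edge {a, c}) 1 - axis (Abs_edge {b, c}) 1"
      using abc(1) ijk by (simp add: tri_def lin linear_diff ev edge_vec_def[of a] edge_vec_def[of b])
    \<comment> \<open>The distinctness conditions of \<open>axis_triangle_eq\<close> come from
      injectivity of \<open>f\<close> on one side and from the triangle \<open>a\<close>,
      \<open>b\<close>, \<open>c\<close> on the other.\<close>
    moreover have "Abs_edge (f i k) \<noteq> Abs_edge (f j k)"
      using ev[OF ijk(2)] ev[OF ijk(3)] f_inj[OF _ ijk(2,3)] ijk(1)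
      by (metis doubleton_eq_iff)
    moreover have "Abs_edge {a, b} \<noteq> Abs_edge {a, c}" "Abs_edge {a, b} \<noteq> Abs_edge {b, c}"
      using abc by (auto simp: Abs_edge_eq_iff doubleton_eq_iff)
    ultimately have "Abs_edge (f i j) = Abs_edge {a, b}"
      "{Abs_edge (f i k), Abs_edge (f j k)} = {Abs_edge {a, c}, Abs_edge {b, c}}"
      using axis_triangle_eq by blast+
    then have "f i j = {a, b}" "f i k = {a, c} \<and> f j k = {b, c} \<or> f i k = {b, c} \<and> f j k = {a, c}"
      using ev[OF ijk(1)] ev[OF ijk(2)] ev[OF ijk(3)] abc Rep_Abs_edge
      by (metis, metis doubleton_eq_iff)
    then show ?thesis
    proof (elim disjE)
      assume "f i k = {a, c} \<and> f j k = {b, c}"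
      then show ?thesis using \<open>f i j = {a, b}\<close> abc(2-4) by blast
    next
      assume "f i k = {b, c} \<and> f j k = {a, c}"
      then show ?thesis using \<open>f i j = {a, b}\<close> abc(2-4)
        by (rule_tac x = b in exI, rule_tac x = a in exI, rule_tac x = c in exI) auto
    qed
  qed
  have other: "\<exists>k. k \<noteq> i \<and> k \<noteq> j" for i j :: 'n
  proof -
    have "card {i, j} < CARD('n)" using n by (simp add: card_insert_if)
    then have "{i, j} \<noteq> UNIV" by (metis less_irrefl)
    then show ?thesis by auto
  qed
  \<comment> \<open>Let the images of two edges at \<open>i\<close> share \<open>a\<close>. The
    image of a further edge at \<open>i\<close> meets both; if it avoided \<open>a\<close>, it would
    be the third side of the image triangle, against injectivity.\<close>
  have "\<exists>p. \<forall>j. j \<noteq> i \<longrightarrow> p \<in> f i j" for i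
  proof -
    obtain j where j: "j \<noteq> i" using other by blast
    obtain k where k: "k \<noteq> i" "k \<noteq> j" using other by blast
    obtain a b c where abc: "f i j = {a, b}" "f i k = {a, c}" "f j k = {b, c}" "a \<noteq> b" "a \<noteq> c" "b \<noteq> c"
      using f_tri[of i j k] j k by metis
    have "a \<in> f i l" if l: "l \<noteq> i" for l
    proof (rule ccontr)
      assume a: "a \<notin> f i l"
      then have ljk: "l \<noteq> j" "l \<noteq> k" using abc by auto
      have "f i j \<inter> f i l \<noteq> {}" using f_tri[of i j l] j l ljk by force
      moreover have "f i k \<inter> f i l \<noteq> {}" using f_tri[of i k l] k l ljk by force
      ultimately have "b \<in> f i l" "c \<in> f i l" using a abc by auto
      then have "f i l = f j k" using f[of i l] l abc by auto
      then have "{i, l} = {j, k}" using f_inj l k by metis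
      then show False using j k by auto
    qed
    then show ?thesis by blast
  qed
  then obtain s where s: "\<And>i j. j \<noteq> i \<Longrightarrow> s i \<in> f i j" by metis
  have "inj s"
  proof (rule injI, rule ccontr)
    fix i j assume ij: "s i = s j" "i \<noteq> j"
    obtain k where k: "k \<noteq> i" "k \<noteq> j" using other by blast
    \<comment> \<open>No vertex lies on all three sides of the image triangle.\<close>
    have "s i \<in> f i j" "s i \<in> f i k" "s i \<in> f j k" using s[of j i] s[of k i] s[of k j] ij k by auto
    then show False using f_tri[of i j k] ij k by auto
  qed
  then have bij: "bij s" by (simp add: bij_def finite_UNIV_inj_surj)
  have "g = vperm s"
  proof (rule linear_eq_edge_vec[OF lin linear_vperm])
    fix i j :: 'n assume ij: "i \<noteq> j"
    then have "s i \<noteq> s j" "s i \<in> f i j" "s j \<in> f i j"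
      using \<open>inj s\<close> s[of j i] s[of i j] f_sym[OF ij] by (auto simp: inj_eq)
    moreover obtain p q where "f i j = {p, q}" "p \<noteq> q" "g (edge_vec i j) = edge_vec p q"
      using f[OF ij] by blast
    ultimately have "g (edge_vec i j) = edge_vec (s i) (s j)" by (auto simp: edge_vec_sym)
    then show "g (edge_vec i j) = vperm s (edge_vec i j)" by (simp add: vperm_edge_vec bij ij)
  qed
  then show thesis using that bij by blast
qed

lemma met_symmetry_group:
  assumes "5 \<le> CARD('n::card2)"
  shows "carrier (symmetry_group (met_cone :: (real ^ 'n edge) set)) = vperm ` {s. bij s}"
proof (intro equalityI subsetI)
  fix g assume g: "g \<in> carrier (symmetry_group (met_cone :: (real ^ 'n edge) set))"
  obtain s where "bij s" "g = vperm s" by (rule met_symmetry_vperm[OF assms g])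
  then show "g \<in> vperm ` {s. bij s}" by blast
qed (auto simp: vperm_symmetry_met)

subsection \<open>Four points\<close>

lemma cut_in_cut_cone: "cut S \<in> cut_cone"
proof (cases "cut S = 0")
  case True
  then show ?thesis by (simp add: cut_cone_def convex_cone_hull_contains_0)
next
  case False
  then show ?thesis unfolding cut_cone_def by (intro hull_inc) blast
qed

lemma cut_cone_subset_met_cone: "cut_cone \<subseteq> met_cone"
  unfolding cut_cone_def
proof (rule hull_minimal)
  show "{cut S | S. cut S \<noteq> 0} \<subseteq> met_cone"
    by (auto simp: met_cone_def coord_cut)
  have *: "met_cone = \<Inter> ((\<lambda>v. {x. v \<bullet> x \<le> 0}) ` triangle_normals)"
    by (auto simp: met_cone_eq)
  show "convex_cone met_cone"
    unfolding * by (intro convex_cone_Inter) (auto intro: convex_cone_halfspace_le)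
qed

lemma card_4_cases:
  assumes "CARD('n) = 4"
  obtains a b c d :: 'n where "UNIV = {a, b, c, d}" "distinct [a, b, c, d]"
proof -
  have "finite (UNIV :: 'n set)" using assms by (metis card.infinite zero_neq_numeral)
  then obtain xs where xs: "set xs = (UNIV :: 'n set)" "distinct xs"
    using finite_distinct_list by blast
  then have "length xs = 4" using assms by (metis distinct_card)
  then obtain a b c d where "xs = [a, b, c, d]"
    by (auto simp: numeral_eq_Suc length_Suc_conv)
  then show thesis by (intro that[of a b c d]) (use xs in auto)
qed

text \<open>The assumptions \<open>min\<close> say that \<open>{a, b}\<close> and
  \<open>{c, d}\<close> form the perfect matching with the largest sum of coordinates. Then
  \<open>x\<close> is an explicit nonnegative combination of all cuts except that of
  \<open>{a, b}\<close>, which separates neither of these pairs.\<close>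

lemma met_cone_4_aux:
  fixes x :: "real ^ ('n::card2) edge"
  assumes x: "x \<in> met_cone" and U: "UNIV = {a, b, c, d}" and d: "distinct [a, b, c, d]"
    and min: "coord x a d + coord x b d - coord x a b \<le> coord x a d + coord x c d - coord x a c"
      "coord x a d + coord x b d - coord x a b \<le> coord x b d + coord x c d - coord x b c"
  shows "x \<in> cut_cone"
proof -
  have tri: "coord x i j \<le> coord x i k + coord x j k" if "i \<noteq> j" "i \<noteq> k" "j \<noteq> k" for i j k
    using x that unfolding met_cone_def by force
  \<comment> \<open>\<open>p\<close>, \<open>q\<close>, \<open>r\<close>, \<open>s\<close> are
    halves of triangle slacks; \<open>t\<close> and \<open>u\<close> are halves of the slacks in
    \<open>min\<close>.\<close>
  define p q r s t u where
    "p = (coord x a c + coord x a d - coord x c d) / 2"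
    "q = (coord x b c + coord x b d - coord x c d) / 2"
    "r = (coord x a c + coord x b c - coord x a b) / 2"
    "s = (coord x a d + coord x b d - coord x a b) / 2"
    "t = (coord x c d + coord x a b - coord x a c - coord x b d) / 2"
    "u = (coord x c d + coord x a b - coord x b c - coord x a d) / 2"
  note defs = this
  have nonneg: "0 \<le> p" "0 \<le> q" "0 \<le> r" "0 \<le> s" "0 \<le> t" "0 \<le> u"
    using min d tri[of c d a] tri[of c d b] tri[of a b c] tri[of a b d]
    by (auto simp: defs coord_sym[of x c a] coord_sym[of x c b] coord_sym[of x d a] coord_sym[of x d b])
  have "x = p *\<^sub>R cut {a} + q *\<^sub>R cut {b} + r *\<^sub>R cut {c} + s *\<^sub>R cut {d}
      + t *\<^sub>R cut {a, c} + u *\<^sub>R cut {b, c}" (is "x = ?y")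
  proof (rule coord_ext)
    fix i j :: 'n assume ij: "i \<noteq> j"
    have "a \<noteq> b" "a \<noteq> c" "a \<noteq> d" "b \<noteq> c" "b \<noteq> d" "c \<noteq> d" using d by auto
    note ne = this this[symmetric]
    have *: "coord x a b = coord ?y a b" "coord x a c = coord ?y a c" "coord x a d = coord ?y a d"
      "coord x b c = coord ?y b c" "coord x b d = coord ?y b d" "coord x c d = coord ?y c d"
      using ne by (simp_all add: coord_cut) (simp_all add: defs field_simps)
    have "i \<in> {a, b, c, d}" "j \<in> {a, b, c, d}" using U by auto
    then consider "{i, j} = {a, b}" | "{i, j} = {a, c}" | "{i, j} = {a, d}"
      | "{i, j} = {b, c}" | "{i, j} = {b, d}" | "{i, j} = {c, d}"
      using ij by auto
    then show "coord x i j = coord ?y i j"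
      using * by cases (simp_all only: coord_def)
  qed
  moreover have "?y \<in> cut_cone"
    using nonneg cut_in_cut_cone unfolding cut_cone_def
    by (intro convex_cone_hull_add convex_cone_hull_mul)
  ultimately show ?thesis by simp
qed

lemma met_cone_4:
  assumes "CARD('n::card2) = 4"
  shows "(met_cone :: (real ^ 'n edge) set) = cut_cone"
proof (rule equalityI[OF subsetI cut_cone_subset_met_cone])
  fix x :: "real ^ 'n edge" assume x: "x \<in> met_cone"
  obtain a b c d :: 'n where U: "UNIV = {a, b, c, d}" and d: "distinct [a, b, c, d]"
    using card_4_cases[OF assms] .
  let ?s = "\<lambda>i j. coord x i d + coord x j d - coord x i j"
  \<comment> \<open>The smallest of the three values \<open>?s\<close> determines the naming of
    \<open>a\<close>, \<open>b\<close>, \<open>c\<close>.\<close>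
  consider "?s a b \<le> ?s a c" "?s a b \<le> ?s b c" | "?s a c \<le> ?s a b" "?s a c \<le> ?s c b"
    | "?s b c \<le> ?s b a" "?s b c \<le> ?s c a"
    by (simp add: coord_sym[of x c b] coord_sym[of x c a] coord_sym[of x b a]) linarith
  then show "x \<in> cut_cone"
  proof cases
    case 1
    then show ?thesis using met_cone_4_aux[OF x U d] by simp
  next
    case 2
    have "UNIV = {a, c, b, d}" using U by auto
    then show ?thesis using met_cone_4_aux[OF x, of a c b d] 2 d by auto
  next
    case 3
    have "UNIV = {b, c, a, d}" using U by auto
    then show ?thesis using met_cone_4_aux[OF x, of b c a d] 3 d by auto
  qed
qed

text \<open>A linear map is fixed on a basis inside \<open>R\<close>. On the rest of
  \<open>R\<close>, which may be linearly dependent, it agrees with \<open>f\<close> because inner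
  products with a spanning set determine a vector.\<close>

lemma orthogonal_extension:
  fixes R :: "'a::euclidean_space set" and f :: "'a \<Rightarrow> 'a"
  assumes span: "span R = UNIV" and inner: "\<And>x y. x \<in> R \<Longrightarrow> y \<in> R \<Longrightarrow> f x \<bullet> f y = x \<bullet> y"
  obtains g where "orthogonal_transformation g" "\<And>x. x \<in> R \<Longrightarrow> g x = f x"
proof -
  obtain B where B: "B \<subseteq> R" "independent B" "R \<subseteq> span B"
    using maximal_independent_subset by blast
  then have spanB: "span B = UNIV" using span by (metis span_mono span_span top.extremum_uniqueI)
  have "\<exists>g. linear g \<and> (\<forall>b\<in>B. g b = f b)" using B(2) by (rule linear_independent_extend)
  then obtain g where g: "linear g" "\<And>b. b \<in> B \<Longrightarrow> g b = f b" by blast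
  have eqI: "h x = k x" if "linear h" "linear k" "\<And>b. b \<in> B \<Longrightarrow> h b = k b" for h k :: "'a \<Rightarrow> real" and x
    using linear_eq_on[OF that(1,2)] spanB that(3) by blast
  have lin: "linear (\<lambda>y. a \<bullet> g y)" "linear (\<lambda>y. a \<bullet> y)" for a
    using linear_compose[OF g(1) bounded_linear.linear[OF bounded_linear_inner_right[of a]]]
    by (auto simp: o_def bounded_linear.linear bounded_linear_inner_right)
  \<comment> \<open>Both sides are linear in \<open>y\<close> and agree on the basis.\<close>
  have fg: "f x \<bullet> g y = x \<bullet> y" if "x \<in> R" for x y
    by (rule eqI[of "\<lambda>y. f x \<bullet> g y" "\<lambda>y. x \<bullet> y"]) (use lin g(2) B(1) inner that in auto)
  have gg: "g x \<bullet> g y = x \<bullet> y" for x y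
  proof (rule eqI[of "\<lambda>y. g x \<bullet> g y" "\<lambda>y. x \<bullet> y"])
    fix b assume "b \<in> B"
    then show "g x \<bullet> g b = x \<bullet> b" using g(2) B(1) fg[of b x] by (auto simp: inner_commute)
  qed (use lin in auto)
  have "g x = f x" if "x \<in> R" for x
  proof -
    have "(g x - f x) \<bullet> (g x - f x) = 0"
      using fg[OF that, of x] inner[OF that that] gg[of x x]
      by (simp add: inner_diff_left inner_diff_right inner_commute)
    then show ?thesis by simp
  qed
  then show thesis using that g(1) gg by (auto simp: orthogonal_transformation_def)
qed

section \<open>The seven cuts on four vertices\<close>

definition single_cuts :: "(real ^ ('n::card2) edge) set"
  where "single_cuts = range (\<lambda>i. cut {i})"

definition pair_cuts :: "(real ^ ('n::card2) edge) set"
  where "pair_cuts = {cut S | S. card S = 2}"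

context
  assumes card4: "CARD('n::card2) = 4"
begin

lemma cuts_4: "{cut S | S :: 'n set. cut S \<noteq> 0} = single_cuts \<union> pair_cuts"
proof (intro equalityI subsetI)
  fix x assume "x \<in> {cut S | S :: 'n set. cut S \<noteq> 0}"
  then obtain S :: "'n set" where S: "x = cut S" "S \<noteq> {}" "S \<noteq> UNIV" by (auto simp: cut_eq_0_iff)
  have "card S < 4" using S(3) card4 by (metis psubset_card_mono finite top.not_eq_extremum)
  moreover have "card S \<noteq> 0" using S(2) by simp
  ultimately consider "card S = 1 \<or> card (- S) = 1" | "card S = 2"
    using card4 by (fastforce simp: card_Compl)
  then show "x \<in> single_cuts \<union> pair_cuts"
  proof cases
    case 1
    then obtain i where "cut S = cut {i}" by (rule cut_singletonI)
    then show ?thesis using S by (simp add: single_cuts_def)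
  next
    case 2
    then show ?thesis using S by (auto simp: pair_cuts_def)
  qed
next
  have "{i} \<noteq> UNIV" for i :: 'n
  proof
    assume "{i} = UNIV"
    then have "card {i} = CARD('n)" by simp
    then show False using card4 by simp
  qed
  moreover have "S \<noteq> UNIV \<and> S \<noteq> {}" if "card S = 2" for S :: "'n set" using that card4 by auto
  moreover fix x :: "real ^ 'n edge" assume "x \<in> single_cuts \<union> pair_cuts"
  ultimately show "x \<in> {cut S | S :: 'n set. cut S \<noteq> 0}"
    by (auto simp: single_cuts_def pair_cuts_def cut_eq_0_iff) (metis cut_eq_0_iff)+
qed

lemma inner_single_cuts:
  fixes x y :: "real ^ 'n edge"
  assumes "x \<in> single_cuts" "y \<in> single_cuts"
  shows "x \<bullet> y = (if x = y then 3 else 1)"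
  using assms card4 by (auto simp: single_cuts_def cut_singleton_inner card_Compl cut_singleton_eq_iff)

lemma inner_single_pair_cuts:
  fixes x y :: "real ^ 'n edge"
  assumes "x \<in> single_cuts" "y \<in> pair_cuts"
  shows "x \<bullet> y = 2"
  using assms card4 by (auto simp: single_cuts_def pair_cuts_def cut_singleton_inner card_Compl)

lemma inner_pair_cuts:
  fixes x y :: "real ^ 'n edge"
  assumes "x \<in> pair_cuts" "y \<in> pair_cuts"
  shows "x \<bullet> y = (if x = y then 4 else 2)"
proof (cases "x = y")
  case True
  then show ?thesis using assms card4
    by (auto simp: pair_cuts_def card_Compl dot_square_norm norm_cut)
next
  case False
  obtain S T :: "'n set" where ST: "x = cut S" "y = cut T" "card S = 2" "card T = 2"
    using assms by (auto simp: pair_cuts_def)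
  then have ne: "S \<noteq> T" "S \<noteq> - T" using False by (auto simp: cut_eq_iff)
  \<comment> \<open>Two pairs that are neither equal nor complementary share exactly one vertex; all
    four parts then have size 1 and the inner product is 1 + 1.\<close>
  define k where "k = card (S \<inter> T)"
  have 1: "card (S - T) = 2 - k" "card (T - S) = 2 - k"
    using ST by (simp_all add: k_def card_Diff_subset_Int Int_commute)
  have "card (S \<union> T) = 4 - k" "k \<le> 2"
    using card_Un_Int[of S T] ST card_mono[of S "S \<inter> T"] by (simp_all add: k_def)
  moreover have "- S \<inter> - T = - (S \<union> T)" by simp
  ultimately have 2: "card (- S \<inter> - T) = k"
    using card4 by (simp only: card_Compl)
  have "k \<noteq> 2"
  proof
    assume "k = 2"
    then have "S \<inter> T = S" "S \<inter> T = T"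
      using ST by (intro card_subset_eq; simp add: k_def)+
    then show False using ne by simp
  qed
  moreover have "k \<noteq> 0"
  proof
    assume "k = 0"
    then have "S \<inter> T = {}" by (simp add: k_def)
    then have "S \<subseteq> - T" by auto
    moreover have "card S = card (- T)" using ST card4 by (simp add: card_Compl)
    ultimately show False using ne by (simp add: card_subset_eq)
  qed
  ultimately have "k = 1" using \<open>k \<le> 2\<close> by simp
  then show ?thesis using 1 2 False by (simp add: ST(1,2) cut_inner k_def[symmetric])
qed

lemma card_single_cuts: "card (single_cuts :: (real ^ 'n edge) set) = 4"
  unfolding single_cuts_def using card4
  by (subst card_image) (auto simp: inj_on_def cut_singleton_eq_iff)

text \<open>Passing to the complement if necessary, every cut of a pair is represented by a pair
  containing \<open>a\<close>.\<close>

lemma card_pair_cuts: "card (pair_cuts :: (real ^ 'n edge) set) = 3"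
proof -
  obtain a b c d :: 'n where U: "UNIV = {a, b, c, d}" and d: "distinct [a, b, c, d]"
    using card_4_cases[OF card4] .
  have sub: "cut S \<in> {cut {a, b}, cut {a, c}, cut {a, d}}" if S: "card S = 2" "a \<in> S" for S :: "'n set"
  proof -
    obtain x where x: "S = {a, x}" "x \<noteq> a" using S by (auto simp: card_2_iff)
    moreover have "x \<in> {a, b, c, d}" using U by auto
    ultimately show ?thesis by auto
  qed
  have "cut S \<in> {cut {a, b}, cut {a, c}, cut {a, d}}" if S: "card S = 2" for S :: "'n set"
  proof (cases "a \<in> S")
    case False
    then have "cut (- S) \<in> {cut {a, b}, cut {a, c}, cut {a, d}}"
      using S card4 by (intro sub) (auto simp: card_Compl)
    moreover have "cut (- S) = cut S" by (simp add: cut_eq_iff)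
    ultimately show ?thesis by simp
  qed (use sub S in blast)
  moreover have "cut {a, x} \<in> pair_cuts" if "x \<noteq> a" for x :: 'n
    using that by (auto simp: pair_cuts_def intro!: exI[of _ "{a, x}"])
  ultimately have eq: "pair_cuts = {cut {a, b}, cut {a, c}, cut {a, d}}"
    using d by (auto simp: pair_cuts_def)
  have "cut {a, x} \<noteq> cut {a, y}" if "x \<noteq> y" "x \<noteq> a" "y \<noteq> a" for x y :: 'n
    using that by (auto simp: cut_eq_iff doubleton_eq_iff)
  then show ?thesis unfolding eq using d by (auto simp: card_insert_if)
qed

lemma linear_eq_cuts_4:
  fixes f g :: "real ^ 'n edge \<Rightarrow> 'b::real_vector"
  assumes "linear f" "linear g" "\<And>x. x \<in> single_cuts \<union> pair_cuts \<Longrightarrow> f x = g x"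
  shows "f = g"
proof (rule linear_eq_edge_vec[OF assms(1,2)])
  fix i j :: 'n assume "i \<noteq> j"
  then have e: "edge_vec i j = (1 / 2) *\<^sub>R (cut {i} + cut {j} - cut {i, j})"
    and "card {i, j} = 2" by (simp_all add: cut_sum_edge_vec)
  then have "f (cut {i}) = g (cut {i})" "f (cut {j}) = g (cut {j})" "f (cut {i, j}) = g (cut {i, j})"
    by (intro assms(3); auto simp: single_cuts_def pair_cuts_def)+
  then show "f (edge_vec i j) = g (edge_vec i j)"
    using assms(1,2) unfolding e by (simp add: linear_cmul linear_add linear_diff)
qed

lemma span_cuts_4: "span (single_cuts \<union> pair_cuts) = (UNIV :: (real ^ 'n edge) set)"
proof -
  have "axis e 1 \<in> span (single_cuts \<union> pair_cuts)" for e :: "'n edge"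
  proof -
    obtain i j where ij: "i \<noteq> j" "e = Abs_edge {i, j}" by (rule edge_cases)
    then have "axis e 1 = (1 / 2) *\<^sub>R (cut {i} + cut {j} - cut {i, j})"
      by (simp add: cut_sum_edge_vec edge_vec_def)
    also have "\<dots> \<in> span (single_cuts \<union> pair_cuts)"
      using ij(1) by (intro span_scale span_diff span_add span_base)
        (auto simp: single_cuts_def pair_cuts_def intro!: exI[of _ "{i, j}"])
    finally show ?thesis .
  qed
  then have "Basis \<subseteq> span (single_cuts \<union> pair_cuts :: (real ^ 'n edge) set)"
    by (auto simp: Basis_vec_def)
  then show ?thesis by (metis span_Basis span_mono span_span top.extremum_uniqueI)
qed

text \<open>The cuts of single vertices are permuted by the general result. The cuts of pairs go to
  positive multiples of the remaining cuts, and comparing lengths makes the multiples 1.\<close>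

lemma cut_symmetry_4:
  fixes g :: "real ^ 'n edge \<Rightarrow> real ^ 'n edge"
  assumes g: "g \<in> carrier (symmetry_group cut_cone)"
  shows "g ` single_cuts = single_cuts" "g ` pair_cuts = pair_cuts"
proof -
  have og: "orthogonal_transformation g" using g by (simp add: symmetry_group_carrier)
  have inj: "inj g" using og by (rule orthogonal_transformation_inj)
  have lin: "linear g" using og by (rule orthogonal_transformation_linear)
  have "3 \<le> CARD('n)" using card4 by simp
  then obtain s where s: "bij s" "\<And>i. g (cut {i}) = cut {s i}"
    using cut_symmetry_singleton g by blast
  then have "g ` single_cuts = (\<lambda>i. cut {s i}) ` UNIV" by (simp add: single_cuts_def image_image)
  also have "\<dots> = (\<lambda>i. cut {i}) ` range s" by (simp add: image_image)
  also have "\<dots> = single_cuts" using s(1) by (simp add: bij_is_surj single_cuts_def)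
  finally show single: "g ` single_cuts = single_cuts" .
  have "g ` pair_cuts \<subseteq> pair_cuts"
  proof
    fix y assume "y \<in> g ` pair_cuts"
    then obtain x where x: "x \<in> pair_cuts" "y = g x" by blast
    then obtain S where S: "x = cut S" "cut S \<noteq> 0" using cuts_4 by blast
    obtain T c where T: "cut T \<noteq> 0" "0 < c" "g x = c *\<^sub>R cut T"
      using cut_symmetry_image[OF g S(2)] S(1) by metis
    \<comment> \<open>Otherwise \<open>x\<close> would be \<open>c\<close> times a cut of a single
      vertex, and the inner products 2 and 4 would force c = 2 / 3 and c * c = 4 / 3.\<close>
    have "cut T \<notin> single_cuts"
    proof
      assume "cut T \<in> single_cuts"
      then obtain z where z: "z \<in> single_cuts" "cut T = g z" using single by blast
      then have "g x = g (c *\<^sub>R z)" using T(3) lin by (simp add: linear_cmul)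
      then have xz: "x = c *\<^sub>R z" using inj by (simp add: inj_eq)
      have "z \<bullet> x = 2" "z \<bullet> z = 3" "x \<bullet> x = 4"
        using z x by (simp_all add: inner_single_pair_cuts inner_single_cuts inner_pair_cuts)
      then have "c * 3 = 2" "c * c * 3 = 4" by (simp_all add: xz)
      then show False by (simp add: field_simps)
    qed
    then have T': "cut T \<in> pair_cuts" using cuts_4 T(1) by blast
    have "4 = c * c * (4 :: real)"
      using og x T(3) inner_pair_cuts[OF x(1) x(1)] inner_pair_cuts[OF T' T']
      by (metis inner_scaleR_left inner_scaleR_right mult.assoc orthogonal_transformation_def)
    then have "c\<^sup>2 = 1" by (simp add: power2_eq_square)
    then have "c = 1" using T(2) by (simp add: power2_eq_1_iff)
    then show "y \<in> pair_cuts" using T T' x by simp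
  qed
  moreover have "finite (pair_cuts :: (real ^ 'n edge) set)"
    using card_pair_cuts by (metis card.infinite zero_neq_numeral)
  moreover have "card (g ` pair_cuts) = card (pair_cuts :: (real ^ 'n edge) set)"
    using inj by (simp add: card_image inj_on_subset)
  ultimately show "g ` pair_cuts = pair_cuts" by (simp add: card_subset_eq)
qed

lemma cut_symmetry_4_extension:
  assumes p: "bij_betw p pair_cuts (pair_cuts :: (real ^ 'n edge) set)"
    and q: "bij_betw q single_cuts (single_cuts :: (real ^ 'n edge) set)"
  obtains g where "g \<in> carrier (symmetry_group cut_cone)"
    "\<And>x. x \<in> pair_cuts \<Longrightarrow> g x = p x" "\<And>x. x \<in> single_cuts \<Longrightarrow> g x = q x"
proof -
  define f where "f x = (if x \<in> pair_cuts then p x else q x)" for x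
  \<comment> \<open>The two kinds of cuts are told apart by their squared lengths 3 and 4, so
    \<open>f\<close> combines \<open>p\<close> and \<open>q\<close> consistently.\<close>
  have disj: "x \<notin> pair_cuts" if "x \<in> single_cuts" for x :: "real ^ 'n edge"
    using that inner_single_cuts[of x x] inner_pair_cuts[of x x] by auto
  have fp: "f x = p x" "p x \<in> pair_cuts" if "x \<in> pair_cuts" for x
    using that p by (auto simp: f_def bij_betw_def)
  have fq: "f x = q x" "q x \<in> single_cuts" if "x \<in> single_cuts" for x
    using that q disj by (auto simp: f_def bij_betw_def)
  have pi: "p x = p y \<longleftrightarrow> x = y" if "x \<in> pair_cuts" "y \<in> pair_cuts" for x y
    using that p by (auto simp: bij_betw_def inj_on_def)
  have qi: "q x = q y \<longleftrightarrow> x = y" if "x \<in> single_cuts" "y \<in> single_cuts" for x y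
    using that q by (auto simp: bij_betw_def inj_on_def)
  have "f x \<bullet> f y = x \<bullet> y" if "x \<in> single_cuts \<union> pair_cuts" "y \<in> single_cuts \<union> pair_cuts" for x y
    using that
  proof (elim UnE)
    assume "x \<in> single_cuts" "y \<in> single_cuts"
    then show ?thesis by (simp add: fq inner_single_cuts qi)
  next
    assume "x \<in> single_cuts" "y \<in> pair_cuts"
    then show ?thesis by (simp add: fp fq inner_single_pair_cuts)
  next
    assume "x \<in> pair_cuts" "y \<in> single_cuts"
    then show ?thesis by (simp add: fp fq inner_single_pair_cuts inner_commute[of _ "q y"] inner_commute[of _ y])
  next
    assume "x \<in> pair_cuts" "y \<in> pair_cuts"
    then show ?thesis by (simp add: fp inner_pair_cuts pi)
  qed
  then obtain g where g: "orthogonal_transformation g" "\<And>x. x \<in> single_cuts \<union> pair_cuts \<Longrightarrow> g x = f x"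
    using orthogonal_extension[OF span_cuts_4] by metis
  \<comment> \<open>The extension permutes the generators of the cone and therefore preserves their
    hull.\<close>
  have "g ` (single_cuts \<union> pair_cuts) = f ` (single_cuts \<union> pair_cuts)"
    using g(2) by (rule image_cong[OF refl])
  also have "\<dots> = q ` single_cuts \<union> p ` pair_cuts"
    unfolding image_Un using fp(1) fq(1) by (simp cong: image_cong)
  also have "\<dots> = single_cuts \<union> pair_cuts" using p q by (simp add: bij_betw_def)
  finally have "g ` cut_cone = cut_cone"
    unfolding cut_cone_def cuts_4
    by (simp only: convex_cone_hull_linear_image orthogonal_transformation_linear g(1))
  then show thesis
    using that[of g] g fp(1) fq(1) by (simp add: symmetry_group_carrier)
qed

lemma cut_symmetry_group_4:
  "symmetry_group (cut_cone :: (real ^ 'n edge) set) \<cong> sym_group 3 \<times>\<times> sym_group 4"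
proof -
  let ?G = "symmetry_group (cut_cone :: (real ^ 'n edge) set)"
  have fin: "finite (pair_cuts :: (real ^ 'n edge) set)" "finite (single_cuts :: (real ^ 'n edge) set)"
    using card_pair_cuts card_single_cuts by (metis card.infinite zero_neq_numeral)+
  obtain d :: "nat \<Rightarrow> real ^ 'n edge" where d: "bij_betw d {1..3} pair_cuts"
    using ex_bij_betw_nat_finite_1[OF fin(1)] card_pair_cuts by auto
  obtain e :: "nat \<Rightarrow> real ^ 'n edge" where e: "bij_betw e {1..4} single_cuts"
    using ex_bij_betw_nat_finite_1[OF fin(2)] card_single_cuts by auto
  \<comment> \<open>The factor of degree 3 records the action on the cuts of pairs, the factor of
    degree 4 that on the cuts of single vertices.\<close>
  define F where "F g = (index_perm 3 d g, index_perm 4 e g)" for g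
  have G: "g ` pair_cuts = pair_cuts" "g ` single_cuts = single_cuts" "inj g" "linear g"
    if "g \<in> carrier ?G" for g
    using that cut_symmetry_4[OF that]
    by (auto simp: symmetry_group_carrier orthogonal_transformation_inj orthogonal_transformation_linear)
  have F: "F g \<in> carrier (sym_group 3 \<times>\<times> sym_group 4)" if "g \<in> carrier ?G" for g
    using index_perm_permutes[OF d] index_perm_permutes[OF e] G[OF that]
    by (simp add: F_def sym_group_carrier)
  have "F \<in> iso ?G (sym_group 3 \<times>\<times> sym_group 4)"
    unfolding iso_def hom_def
  proof (intro CollectI conjI ballI bij_betwI' funcsetI F)
    fix g h assume gh: "g \<in> carrier ?G" "h \<in> carrier ?G"
    show "F (g \<otimes>\<^bsub>?G\<^esub> h) = F g \<otimes>\<^bsub>sym_group 3 \<times>\<times> sym_group 4\<^esub> F h"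
      using index_perm_comp[OF d] index_perm_comp[OF e] G[OF gh(1)] G[OF gh(2)]
      by (simp add: F_def sym_group_mult)
    show "(F g = F h) = (g = h)"
    proof
      assume "F g = F h"
      then have "index_perm 3 d g = index_perm 3 d h" "index_perm 4 e g = index_perm 4 e h"
        by (simp_all add: F_def)
      then have "g x = h x" if "x \<in> single_cuts \<union> pair_cuts" for x
        using that index_perm_inj[OF d G(1)[OF gh(1)] G(1)[OF gh(2)]]
          index_perm_inj[OF e G(2)[OF gh(1)] G(2)[OF gh(2)]] by blast
      then show "g = h" using linear_eq_cuts_4[OF G(4)[OF gh(1)] G(4)[OF gh(2)]] by blast
    qed simp
  next
    fix pq assume "pq \<in> carrier (sym_group 3 \<times>\<times> sym_group 4)"
    then obtain p q where pq: "pq = (p, q)" "p permutes {1..3}" "q permutes {1..4}"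
      by (auto simp: sym_group_carrier)
    obtain g where g: "g \<in> carrier ?G"
      "\<And>x. x \<in> pair_cuts \<Longrightarrow> g x = d (p (inv_into {1..3} d x))"
      "\<And>x. x \<in> single_cuts \<Longrightarrow> g x = e (q (inv_into {1..4} e x))"
      using cut_symmetry_4_extension[OF transported_permutes[OF d pq(2)] transported_permutes[OF e pq(3)]]
      by blast
    then show "\<exists>g\<in>carrier ?G. pq = F g"
      using index_perm_surj[OF d pq(2) g(2)] index_perm_surj[OF e pq(3) g(3)]
      by (intro bexI[OF _ g(1)]) (simp add: F_def pq(1))
  qed
  then show ?thesis by (rule is_isoI)
qed

end

theorem theorem1:
  shows "(CARD('n::card2) \<ge> 5 \<longrightarrow>
            symmetry_group (met_cone :: (real ^ 'n edge) set) \<cong> sym_group CARD('n) \<and>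
            symmetry_group (cut_cone :: (real ^ 'n edge) set) \<cong> sym_group CARD('n)) \<and>
         (CARD('n) = 4 \<longrightarrow>
            symmetry_group (met_cone :: (real ^ 'n edge) set) \<cong> sym_group 3 \<times>\<times> sym_group 4 \<and>
            symmetry_group (cut_cone :: (real ^ 'n edge) set) \<cong> sym_group 3 \<times>\<times> sym_group 4)"
proof (intro conjI impI)
  assume n: "CARD('n) \<ge> 5"
  then have "3 \<le> CARD('n)" by simp
  then show "symmetry_group (met_cone :: (real ^ 'n edge) set) \<cong> sym_group CARD('n)"
    "symmetry_group (cut_cone :: (real ^ 'n edge) set) \<cong> sym_group CARD('n)"
    using met_symmetry_group[OF n] cut_symmetry_group[OF n] by (auto intro: symmetry_group_iso_sym)
next
  assume n: "CARD('n) = 4"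
  show "symmetry_group (cut_cone :: (real ^ 'n edge) set) \<cong> sym_group 3 \<times>\<times> sym_group 4"
    by (rule cut_symmetry_group_4[OF n])
  then show "symmetry_group (met_cone :: (real ^ 'n edge) set) \<cong> sym_group 3 \<times>\<times> sym_group 4"
    by (simp only: met_cone_4[OF n])
qed

end
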